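(* Suppose $\Omega\subset\mathbb{C}^d$ is a $\mathbb{C}$-properly convex domain and every domain in $\overline{\mathrm{Aff}(\mathbb{C}^d)\cdot\Omega}\cap\mathbb{X}_d$ has simple boundary. If $\sigma:[0,\infty)\to\Omega$ is a geodesic ray in $(\Omega,K_\Omega)$, then $\lim_{t\to\infty}\sigma(t)$ exists in $\partial_{\mathrm{End}}\Omega$.
   Context: A convex domain in $\mathbb{C}^d$ is $\mathbb{C}$-properly convex if it contains no entire complex affine line; on such a domain the Kobayashi pseudo-distance $K_\Omega$ is a genuine distance. A geodesic ray in $(\Omega,K_\Omega)$ is a map $\sigma:[0,\infty)\to\Omega$ with $K_\Omega(\sigma(s),\sigma(t))=|s-t|$ for all $s,t\ge0$. $\overline{\Omega}^{\mathrm{End}}$ denotes the (Freudenthal) end compactification of the Euclidean closure $\overline{\Omega}$, and $\partial_{\mathrm{End}}\Omega:=\overline{\Omega}^{\mathrm{End}}\setminus\Omega$. $\mathbb{X}_d$ is the set of all non-empty $\mathbb{C}$-properly convex domains in $\mathbb{C}^d$, with the local Hausdorff topology: $\Omega_n\to\Omega$ in $\mathbb{X}_d$ if there is $R_0\ge0$ such that for all $R\ge R_0$ the Hausdorff distance between $\overline{\Omega}_n\cap\overline{B(0;R)}$ and $\overline{\Omega}\cap\overline{B(0;R)}$ tends to $0$, where $B(0;R)$ is the Euclidean ball (the Hausdorff distance between the empty set and a non-empty set is $\infty$). $\mathrm{Aff}(\mathbb{C}^d)$ is the group of complex affine automorphisms of $\mathbb{C}^d$; $\overline{\mathrm{Aff}(\mathbb{C}^d)\cdot\Omega}\cap\mathbb{X}_d$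 is the set of all $\mathcal{D}\in\mathbb{X}_d$ for which there are $A_n\in\mathrm{Aff}(\mathbb{C}^d)$ with $A_n\Omega\to\mathcal{D}$ in $\mathbb{X}_d$. A domain has simple boundary if every holomorphic map from the unit disk $\mathbb{D}\subset\mathbb{C}$ into its boundary is constant. *)

theory Defs
  imports "HOL-Analysis.Analysis"
begin

definition holomorphic_map_on :: "(complex \<Rightarrow> complex ^ 'd) \<Rightarrow> complex set \<Rightarrow> bool" where
  "holomorphic_map_on f S \<longleftrightarrow> (\<forall>i. (\<lambda>z. f z $ i) holomorphic_on S)"

text \<open>The Poincare distance is normalised to have curvature \<open>-4\<close>, i.e. it is the distance of the
  metric \<open>|dz| / (1 - |z|\<^sup>2)\<close>.\<close>

definition poincare_dist :: "complex \<Rightarrow> complex \<Rightarrow> real" where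
  "poincare_dist z w = artanh (cmod ((z - w) / (1 - cnj w * z)))"

text \<open>A chain of \<open>n\<close> analytic discs \<open>f i\<close> in \<open>\<Omega>\<close> joining \<open>x\<close> to \<open>y\<close> through the points \<open>p i\<close>.\<close>

definition disc_chain ::
  "(complex ^ 'd) set \<Rightarrow> complex ^ 'd \<Rightarrow> complex ^ 'd \<Rightarrow> nat \<Rightarrow> (nat \<Rightarrow> complex ^ 'd) \<Rightarrow>
    (nat \<Rightarrow> complex \<Rightarrow> complex ^ 'd) \<Rightarrow> (nat \<Rightarrow> complex) \<Rightarrow> (nat \<Rightarrow> complex) \<Rightarrow> bool" where
  "disc_chain \<Omega> x y n p f a b \<longleftrightarrow>
     p 0 = x \<and> p n = y \<and>
     (\<forall>i<n. holomorphic_map_on (f i) (ball 0 1) \<and> f i ` ball 0 1 \<subseteq> \<Omega> \<and>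
            a i \<in> ball 0 1 \<and> b i \<in> ball 0 1 \<and> f i (a i) = p i \<and> f i (b i) = p (Suc i))"

text \<open>The infimum is taken in \<^typ>\<open>real\<close>, so it is meaningful only when some chain joins \<open>x\<close> to \<open>y\<close>;
  this is so for any two points of a domain \<open>\<Omega>\<close>.\<close>

definition kobayashi_dist :: "(complex ^ 'd) set \<Rightarrow> complex ^ 'd \<Rightarrow> complex ^ 'd \<Rightarrow> real" where
  "kobayashi_dist \<Omega> x y =
     Inf {\<Sum>i<n. poincare_dist (a i) (b i) | n p f a b. disc_chain \<Omega> x y n p f a b}"

definition kobayashi_geodesic_ray :: "(complex ^ 'd) set \<Rightarrow> (real \<Rightarrow> complex ^ 'd) \<Rightarrow> bool" where
  "kobayashi_geodesic_ray \<Omega> \<sigma> \<longleftrightarrow>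
     (\<forall>t\<ge>0. \<sigma> t \<in> \<Omega>) \<and> (\<forall>s\<ge>0. \<forall>t\<ge>0. kobayashi_dist \<Omega> (\<sigma> s) (\<sigma> t) = \<bar>s - t\<bar>)"

text \<open>An end of \<open>X\<close> selects, compatibly with inclusions, a connected component of the complement
  of every compact set \<open>K\<close>. The value off the compact sets is fixed so that distinct functions are
  distinct ends.\<close>

definition ends_of :: "'a topology \<Rightarrow> ('a set \<Rightarrow> 'a set) set" where
  "ends_of X =
     {E. (\<forall>K. compactin X K \<longrightarrow>
              E K \<in> connected_components_of (subtopology X (topspace X - K))) \<and>
         (\<forall>K L. compactin X K \<and> compactin X L \<and> K \<subseteq> L \<longrightarrow> E L \<subseteq> E K) \<and>
         (\<forall>K. \<not> compactin X K \<longrightarrow> E K = {})}"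

text \<open>The points of \<open>X\<close> are embedded by \<^const>\<open>Inl\<close>, the ends by \<^const>\<open>Inr\<close>. The second family
  consists of the basic neighbourhoods of ends; these components are open when \<open>X\<close> is Hausdorff and
  locally connected, as is the closure of a convex set.\<close>

definition end_compactification :: "'a topology \<Rightarrow> ('a + ('a set \<Rightarrow> 'a set)) topology" where
  "end_compactification X = topology_generated_by
     ({Inl ` U | U. openin X U} \<union>
      {Inl ` C \<union> Inr ` {E \<in> ends_of X. E K = C} | K C. compactin X K \<and>
         C \<in> connected_components_of (subtopology X (topspace X - K))})"

definition end_boundary ::
  "('a::topological_space) set \<Rightarrow> ('a + ('a set \<Rightarrow> 'a set)) set" where
  "end_boundary \<Omega> = topspace (end_compactification (top_of_set (closure \<Omega>))) - Inl ` \<Omega>"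

lemma topspace_end_compactification:
  "topspace (end_compactification X) = Inl ` topspace X \<union> Inr ` ends_of X"
proof -
  have sub: "C \<subseteq> topspace X"
    if "C \<in> connected_components_of (subtopology X (topspace X - K))" for C K
    using connected_components_of_subset[OF that] by auto
  have comp: "E {} \<in> connected_components_of (subtopology X (topspace X - {}))"
    if "E \<in> ends_of X" for E
  proof -
    have "\<forall>K. compactin X K \<longrightarrow> E K \<in> connected_components_of (subtopology X (topspace X - K))"
      using that by (simp add: ends_of_def)
    then show ?thesis
      using compactin_empty[of X] by (elim allE[of _ "{}"] mp)
  qed
  have mem: "x \<in> topspace (end_compactification X) \<longleftrightarrow>
      (\<exists>U. openin X U \<and> x \<in> Inl ` U) \<or>
      (\<exists>K C. compactin X K \<and> C \<in> connected_components_of (subtopology X (topspace X - K)) \<and>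
        x \<in> Inl ` C \<union> Inr ` {E \<in> ends_of X. E K = C})" for x
  proof -
    have "x \<in> \<Union> ({f U | U. P U} \<union> {g K C | K C. Q K \<and> R K C}) \<longleftrightarrow>
        (\<exists>U. P U \<and> x \<in> f U) \<or> (\<exists>K C. Q K \<and> R K C \<and> x \<in> g K C)"
      for f :: "'a set \<Rightarrow> _" and g :: "'a set \<Rightarrow> 'a set \<Rightarrow> _" and P Q R
      by blast
    then show ?thesis
      unfolding end_compactification_def topology_generated_by_topspace .
  qed
  show ?thesis
  proof (intro set_eqI iffI)
    fix x assume "x \<in> topspace (end_compactification X)"
    then consider U where "openin X U" "x \<in> Inl ` U"
      | K C where "C \<in> connected_components_of (subtopology X (topspace X - K))"
          "x \<in> Inl ` C \<union> Inr ` {E \<in> ends_of X. E K = C}"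
      unfolding mem by (elim disjE exE conjE)
    then show "x \<in> Inl ` topspace X \<union> Inr ` ends_of X"
    proof cases
      case 1
      then show ?thesis using openin_subset[of X U] by blast
    next
      case 2
      show ?thesis using 2(2) sub[OF 2(1)] by blast
    qed
  next
    fix x assume "x \<in> Inl ` topspace X \<union> Inr ` ends_of X"
    then consider "x \<in> Inl ` topspace X" | E where "E \<in> ends_of X" "x = Inr E" by blast
    then show "x \<in> topspace (end_compactification X)"
    proof cases
      case 1
      then show ?thesis
        unfolding mem by (intro disjI1 exI[of _ "topspace X"] conjI openin_topspace)
    next
      case (2 E)
      have "x \<in> Inl ` E {} \<union> Inr ` {F \<in> ends_of X. F {} = E {}}"
        using 2 by simp
      with comp[OF 2(1)] show ?thesis
        unfolding mem by (intro disjI2 exI[of _ "{}"] exI[of _ "E {}"] conjI compactin_empty)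
    qed
  qed
qed

definition C_properly_convex :: "(complex ^ 'd) set \<Rightarrow> bool" where
  "C_properly_convex \<Omega> \<longleftrightarrow>
     open \<Omega> \<and> convex \<Omega> \<and> \<not> (\<exists>p v. v \<noteq> 0 \<and> range (\<lambda>z::complex. p + z *s v) \<subseteq> \<Omega>)"

definition properly_convex_domains :: "(complex ^ 'd) set set"  (\<open>\<bbbX>\<close>) where
  "\<bbbX> = {\<Omega>. \<Omega> \<noteq> {} \<and> C_properly_convex \<Omega>}"

text \<open>In \<^typ>\<open>ennreal\<close> suprema over \<open>{}\<close> are \<open>0\<close> and infima over \<open>{}\<close> are \<open>\<infinity>\<close>, so this distance is
  \<open>\<infinity>\<close> if exactly one of the two sets is empty and \<open>0\<close> if both are.\<close>

definition hausdorff_distance :: "'a::metric_space set \<Rightarrow> 'a set \<Rightarrow> ennreal" where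
  "hausdorff_distance A B =
     max (SUP a\<in>A. INF b\<in>B. ennreal (dist a b)) (SUP b\<in>B. INF a\<in>A. ennreal (dist a b))"

definition local_hausdorff_tendsto ::
  "(nat \<Rightarrow> (complex ^ 'd) set) \<Rightarrow> (complex ^ 'd) set \<Rightarrow> bool" where
  "local_hausdorff_tendsto \<Omega>s \<Omega> \<longleftrightarrow>
     (\<exists>R0\<ge>0. \<forall>R\<ge>R0.
        (\<lambda>n. hausdorff_distance (closure (\<Omega>s n) \<inter> closure (ball 0 R)) (closure \<Omega> \<inter> closure (ball 0 R)))
          \<longlonglongrightarrow> 0)"

definition Aff :: "(complex ^ 'd \<Rightarrow> complex ^ 'd) set" where
  "Aff = {\<lambda>z. A *v z + b | (A :: complex ^ 'd ^ 'd) b. invertible A}"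

definition aff_orbit_closure :: "(complex ^ 'd) set \<Rightarrow> (complex ^ 'd) set set" where
  "aff_orbit_closure \<Omega> =
     {D \<in> \<bbbX>. \<exists>A. (\<forall>n. A n \<in> Aff) \<and> local_hausdorff_tendsto (\<lambda>n. A n ` \<Omega>) D}"

definition simple_boundary :: "(complex ^ 'd) set \<Rightarrow> bool" where
  "simple_boundary D \<longleftrightarrow>
     (\<forall>f. holomorphic_map_on f (ball 0 1) \<and> f ` ball 0 1 \<subseteq> frontier D \<longrightarrow> f constant_on ball 0 1)"

end

theory Submission
  imports Defs "HOL-Complex_Analysis.Complex_Analysis"
begin

text \<open>Let \<open>\<delta>(p)\<close> be the distance of \<open>p\<close> to the complement of \<open>\<Omega>\<close>. Chains of affine discs show that
  \<open>\<delta>\<close> decays exponentially along a geodesic ray \<open>\<sigma>\<close> as long as \<open>\<sigma>\<close> stays in a bounded set.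
  The hypothesis on the affine orbit closure implies that, on bounded sets, affine discs centred at
  \<open>p\<close> have radius \<open>O(\<delta>(p)\<^sup>\<alpha>)\<close> for some \<open>\<alpha> > 0\<close>: otherwise one could zoom in at points where moving away
  from the boundary by a large multiple of \<open>\<delta>(p)\<close> hardly enlarges the discs, and a limit of affine
  images of \<open>\<Omega>\<close> would have a complex sector in its boundary. Since supporting complex hyperplanes
  bound \<open>K\<^sub>\<Omega>(p, q)\<close> from below in terms of \<open>|q - p|\<close> divided by the radius of the discs at \<open>p\<close> in the
  direction \<open>q - p\<close>, the displacements of \<open>\<sigma>\<close> over unit time near a finite accumulation point are
  summable, so \<open>\<sigma>\<close> converges to that point. Without finite accumulation points, the continuous curve
  \<open>\<sigma>\<close> leaves every compact set and determines an end.\<close>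

subsection \<open>Lower bounds for the Kobayashi distance\<close>

lemma strip_deriv_bound:
  assumes hol: "g holomorphic_on ball 0 1"
    and strip: "\<And>z. z \<in> ball 0 1 \<Longrightarrow> \<bar>Im (g z)\<bar> < pi / 2"
    and z: "z \<in> ball 0 1"
  shows "cmod (deriv g z) \<le> 2 * exp pi / (1 - cmod z)"
proof -
  define r where "r = (1 - cmod z) / 2"
  have r: "r > 0" using z by (simp add: r_def)
  have sub: "cball z r \<subseteq> ball 0 1"
  proof
    fix w assume "w \<in> cball z r"
    then have "cmod w \<le> cmod z + r"
      using norm_triangle_ineq2[of w z] by (simp add: dist_norm norm_minus_commute)
    then show "w \<in> ball 0 1" using z by (simp add: r_def field_simps)
  qed
  define h where "h w = exp (\<i> * g w)" for w
  have hh: "h holomorphic_on ball 0 1"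
    unfolding h_def by (intro holomorphic_intros hol)
  have hb: "cmod (h w) \<le> exp (pi / 2)" "cmod (h w) \<ge> exp (- (pi / 2))" if "w \<in> ball 0 1" for w
    using strip[OF that] by (auto simp: h_def)
  have "cmod ((deriv ^^ 1) h z) \<le> fact 1 * exp (pi / 2) / r ^ 1"
  proof (rule Cauchy_inequality)
    show "h holomorphic_on ball z r"
      by (rule holomorphic_on_subset[OF hh]) (use sub in auto)
    show "continuous_on (cball z r) h"
      by (rule holomorphic_on_imp_continuous_on, rule holomorphic_on_subset[OF hh]) (use sub in auto)
    show "cmod (h x) \<le> exp (pi / 2)" if "cmod (z - x) = r" for x
      by (rule hb(1)) (use sub that in \<open>auto simp: dist_norm\<close>)
  qed (rule r)
  then have d1: "cmod (deriv h z) \<le> exp (pi / 2) / r" by simp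
  have "(g has_field_derivative deriv g z) (at z)"
    using holomorphic_derivI[OF hol _ z] by simp
  then have "(h has_field_derivative (h z * (\<i> * deriv g z))) (at z)"
    unfolding h_def by (auto intro!: derivative_eq_intros)
  then have "deriv h z = h z * (\<i> * deriv g z)" by (rule DERIV_imp_deriv)
  then have "cmod (h z) * cmod (deriv g z) \<le> exp (pi / 2) / r"
    using d1 by (simp add: norm_mult)
  moreover have "exp (- (pi / 2)) * cmod (deriv g z) \<le> cmod (h z) * cmod (deriv g z)"
    by (intro mult_right_mono hb z) auto
  ultimately have "exp (- (pi / 2)) * cmod (deriv g z) \<le> exp (pi / 2) / r" by linarith
  then have "exp (pi / 2) * (exp (- (pi / 2)) * cmod (deriv g z)) \<le> exp (pi / 2) * (exp (pi / 2) / r)"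
    by (intro mult_left_mono) auto
  moreover have "exp (pi / 2) * exp (- (pi / 2)) = 1" "exp (pi / 2) * exp (pi / 2) = exp pi"
    by (simp_all flip: exp_add)
  ultimately have "cmod (deriv g z) \<le> exp pi * 2 / (1 - cmod z)"
    by (simp add: r_def flip: mult.assoc)
  then show ?thesis by (simp add: mult.commute)
qed

lemma poincare_dist_nonneg:
  assumes "a \<in> ball 0 1" "b \<in> ball 0 1"
  shows "poincare_dist a b \<ge> 0"
proof -
  let ?u = "cmod ((a - b) / (1 - cnj b * a))"
  have u: "?u < 1"
    using Moebius_function_norm_lt_1[of b a 0] assms by (simp add: Moebius_function_simple)
  then have "ln 1 \<le> ln ((1 + ?u) / (1 - ?u))"
    by (intro ln_mono) (auto simp: field_simps)
  then show ?thesis unfolding poincare_dist_def artanh_def by simp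
qed

lemma strip_map_lipschitz_0:
  assumes hol: "g holomorphic_on ball 0 1"
    and strip: "\<And>z. z \<in> ball 0 1 \<Longrightarrow> \<bar>Im (g z)\<bar> < pi / 2"
    and w: "w \<in> ball 0 1"
  shows "cmod (g w - g 0) \<le> 4 * exp pi * artanh (cmod w)"
proof -
  have tw: "t * cmod w < 1" if "0 \<le> t" "t \<le> 1" for t
    using w that mult_left_le_one_le[of "cmod w" t] by auto
  have wb: "of_real t * w \<in> ball 0 1" if "0 \<le> t" "t \<le> 1" for t
    using tw[OF that] that by (simp add: norm_mult)
  have "norm (g (of_real 1 * w) - g (of_real 0 * w)) \<le>
      4 * exp pi * artanh (1 * cmod w) - 4 * exp pi * artanh (0 * cmod w)"
  proof (rule differentiable_bound_general[where f' = "\<lambda>t. w * deriv g (of_real t * w)"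
        and \<phi>' = "\<lambda>t. 4 * exp pi * (cmod w / (1 - (t * cmod w)\<^sup>2))"
        and f = "\<lambda>t. g (of_real t * w)" and \<phi> = "\<lambda>t. 4 * exp pi * artanh (t * cmod w)"])
    show "continuous_on {0..1} (\<lambda>t. g (of_real t * w))"
    proof (rule continuous_on_compose2[of "ball 0 1" g])
      show "continuous_on (ball 0 1) g" by (rule holomorphic_on_imp_continuous_on[OF hol])
      show "continuous_on {0..1} (\<lambda>x. of_real x * w)" by (intro continuous_intros)
    qed (use wb in auto)
    show "continuous_on {0..1} (\<lambda>t. 4 * exp pi * artanh (t * cmod w))"
    proof (intro continuous_intros)
      fix t :: real assume "t \<in> {0..1}"
      then show "t * cmod w \<in> {-1<..<1}"
        using tw[of t] by (auto intro: less_le_trans[of "-1" 0])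
    qed
  next
    fix t :: real assume t: "0 < t" "t < 1"
    have gd: "(g has_field_derivative deriv g (of_real t * w)) (at (of_real t * w))"
      using holomorphic_derivI[OF hol _ wb[of t]] t by simp
    have "((\<lambda>x. of_real x * w) has_vector_derivative w) (at t)"
      by (auto intro!: derivative_eq_intros)
    from field_vector_diff_chain_at[OF this gd]
    show "((\<lambda>t. g (of_real t * w)) has_vector_derivative w * deriv g (of_real t * w)) (at t)"
      by (simp add: o_def)
    have "\<bar>t * cmod w\<bar> < 1" using tw[of t] t by (simp add: abs_mult)
    then show "((\<lambda>t. 4 * exp pi * artanh (t * cmod w)) has_vector_derivative
        4 * exp pi * (cmod w / (1 - (t * cmod w)\<^sup>2))) (at t)"
      unfolding has_real_derivative_iff_has_vector_derivative[symmetric]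
      by (auto intro!: derivative_eq_intros DERIV_chain2[OF artanh_real_has_field_derivative])
    let ?s = "t * cmod w"
    have s: "0 \<le> ?s" "?s < 1" using tw[of t] t by auto
    have "cmod (w * deriv g (of_real t * w)) \<le> cmod w * (2 * exp pi / (1 - ?s))"
      using mult_left_mono[OF strip_deriv_bound[OF hol strip wb[of t]], of "cmod w"] t
      by (simp add: norm_mult)
    also have "\<dots> = 2 * exp pi * cmod w * (1 + ?s) / (1 - ?s\<^sup>2)"
    proof -
      have "1 - ?s\<^sup>2 = (1 - ?s) * (1 + ?s)" by (simp add: power2_eq_square algebra_simps)
      then show ?thesis using s by simp
    qed
    also have "\<dots> \<le> 2 * exp pi * cmod w * 2 / (1 - ?s\<^sup>2)"
      using s by (intro divide_right_mono mult_left_mono) (auto simp: power_le_one)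
    finally show "norm (w * deriv g (of_real t * w)) \<le> 4 * exp pi * (cmod w / (1 - ?s\<^sup>2))"
      by simp
  qed simp_all
  then show ?thesis by simp
qed

lemma strip_map_lipschitz:
  assumes hol: "g holomorphic_on ball 0 1"
    and strip: "\<And>z. z \<in> ball 0 1 \<Longrightarrow> \<bar>Im (g z)\<bar> < pi / 2"
    and a: "a \<in> ball 0 1" and b: "b \<in> ball 0 1"
  shows "cmod (g a - g b) \<le> 4 * exp pi * poincare_dist a b"
proof -
  let ?M = "Moebius_function 0 (- b)" and ?w = "Moebius_function 0 b a"
  have Mb: "?M z \<in> ball 0 1" if "z \<in> ball 0 1" for z
    using Moebius_function_norm_lt_1[of "- b" z 0] that b by simp
  have w: "?w \<in> ball 0 1" using Moebius_function_norm_lt_1[of b a 0] a b by simp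
  have "cmod ((g \<circ> ?M) ?w - (g \<circ> ?M) 0) \<le> 4 * exp pi * artanh (cmod ?w)"
  proof (rule strip_map_lipschitz_0[OF _ _ w])
    show "g \<circ> ?M holomorphic_on ball 0 1"
      by (rule holomorphic_on_compose_gen[OF Moebius_function_holomorphic hol])
        (use b Mb in auto)
  qed (use strip Mb in auto)
  moreover have "?M ?w = a" by (rule Moebius_function_compose) (use a b in auto)
  moreover have "?M 0 = b" by (simp add: Moebius_function_simple)
  ultimately show ?thesis
    by (simp add: poincare_dist_def Moebius_function_simple)
qed

lemma kobayashi_dist_lower:
  fixes g :: "complex ^ 'd \<Rightarrow> complex"
  assumes hol: "\<And>\<phi>. holomorphic_map_on \<phi> (ball 0 1) \<Longrightarrow> \<phi> ` ball 0 1 \<subseteq> \<Omega> \<Longrightarrow> (\<lambda>z. g (\<phi> z)) holomorphic_on ball 0 1"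
    and strip: "\<And>x. x \<in> \<Omega> \<Longrightarrow> \<bar>Im (g x)\<bar> < pi / 2"
    and chain: "disc_chain \<Omega> p q n0 p0 f0 a0 b0"
  shows "cmod (g p - g q) \<le> 4 * exp pi * kobayashi_dist \<Omega> p q"
proof -
  have *: "cmod (g p - g q) / (4 * exp pi) \<le> (\<Sum>i<n. poincare_dist (a i) (b i))"
    if ch: "disc_chain \<Omega> p q n ps f a b" for n ps f a b
  proof -
    have "cmod (g (ps i) - g (ps (Suc i))) \<le> 4 * exp pi * poincare_dist (a i) (b i)" if "i < n" for i
    proof -
      have i: "holomorphic_map_on (f i) (ball 0 1)" "f i ` ball 0 1 \<subseteq> \<Omega>" "a i \<in> ball 0 1" "b i \<in> ball 0 1"
          "f i (a i) = ps i" "f i (b i) = ps (Suc i)"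
        using ch that unfolding disc_chain_def by auto
      show ?thesis
        using strip_map_lipschitz[OF hol[OF i(1,2)] _ i(3,4)] strip i by (simp add: image_subset_iff)
    qed
    then have "(\<Sum>i<n. cmod (g (ps i) - g (ps (Suc i)))) \<le> (\<Sum>i<n. 4 * exp pi * poincare_dist (a i) (b i))"
      by (intro sum_mono) auto
    moreover have "cmod (\<Sum>i<n. g (ps i) - g (ps (Suc i))) \<le> (\<Sum>i<n. cmod (g (ps i) - g (ps (Suc i))))"
      by (rule norm_sum)
    moreover have "(\<Sum>i<n. g (ps i) - g (ps (Suc i))) = g p - g q"
      using ch sum_lessThan_telescope'[of "\<lambda>i. g (ps i)" n] by (simp add: disc_chain_def)
    ultimately show ?thesis by (simp add: sum_distrib_left[symmetric] field_simps)
  qed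
  have "cmod (g p - g q) / (4 * exp pi) \<le> kobayashi_dist \<Omega> p q"
    unfolding kobayashi_dist_def
  proof (rule cInf_greatest)
    show "{\<Sum>i<n. poincare_dist (a i) (b i) |n p' f a b. disc_chain \<Omega> p q n p' f a b} \<noteq> {}"
      using chain by blast
  qed (use * in blast)
  then show ?thesis by (simp add: field_simps)
qed

lemma kobayashi_dist_le_chain:
  assumes "disc_chain \<Omega> p q n ps f a b"
  shows "kobayashi_dist \<Omega> p q \<le> (\<Sum>i<n. poincare_dist (a i) (b i))"
  unfolding kobayashi_dist_def
proof (rule cInf_lower)
  show "bdd_below {\<Sum>i<n. poincare_dist (a i) (b i) |n ps f a b. disc_chain \<Omega> p q n ps f a b}"
    by (rule bdd_belowI[of _ 0])
      (auto simp: disc_chain_def intro!: sum_nonneg poincare_dist_nonneg)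
qed (use assms in blast)

subsection \<open>Affine discs in convex domains\<close>

lemma norm_vector_smult: "norm (c *s v) = cmod c * norm v" for v :: "complex ^ 'd"
  by (simp add: norm_vec_def norm_mult L2_set_right_distrib)

lemma of_real_vector_smult: "complex_of_real r *s v = r *\<^sub>R v" for v :: "complex ^ 'd"
  by (simp add: vec_eq_iff scaleR_conv_of_real[where 'a = complex])

lemma bounded_bilinear_vector_smult:
  "bounded_bilinear (\<lambda>c (v :: complex ^ 'd). c *s v)"
proof
  show "\<exists>K. \<forall>a (b :: complex ^ 'd). norm (a *s b) \<le> norm a * norm b * K"
    by (rule exI[of _ 1]) (simp add: norm_vector_smult)
qed (simp_all add: vec_eq_iff algebra_simps)

lemmas tendsto_vector_smult [tendsto_intros] =
  bounded_bilinear.tendsto[OF bounded_bilinear_vector_smult]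

lemmas continuous_on_vector_smult [continuous_intros] =
  bounded_bilinear.continuous_on[OF bounded_bilinear_vector_smult]

definition disc_in :: "(complex ^ 'd) set \<Rightarrow> complex ^ 'd \<Rightarrow> complex ^ 'd \<Rightarrow> bool" where
  "disc_in \<Omega> p w \<longleftrightarrow> (\<forall>\<zeta>. cmod \<zeta> \<le> 1 \<longrightarrow> p + \<zeta> *s w \<in> closure \<Omega>)"

lemma complex_supporting_functional:
  fixes \<Omega> :: "(complex ^ 'd) set"
  assumes "open \<Omega>" "convex \<Omega>" "\<xi> \<notin> \<Omega>"
  shows "\<exists>h. \<forall>z\<in>\<Omega>. 0 < Re (\<Sum>i\<in>UNIV. cnj (h $ i) * (z $ i - \<xi> $ i))"
proof -
  have inn: "inner h (z - \<xi>) = Re (\<Sum>i\<in>UNIV. cnj (h $ i) * (z $ i - \<xi> $ i))" for h z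
    by (simp add: inner_vec_def inner_complex_def)
  have "convex ((\<lambda>z. z - \<xi>) ` \<Omega>)" "0 \<notin> (\<lambda>z. z - \<xi>) ` \<Omega>"
    using assms by (auto simp: convex_translation_subtract_eq)
  from separating_hyperplane_set_0[OF this]
  obtain h where h: "h \<noteq> 0" "\<And>z. z \<in> \<Omega> \<Longrightarrow> 0 \<le> inner h (z - \<xi>)" by auto
  have "0 < inner h (z - \<xi>)" if z: "z \<in> \<Omega>" for z
  proof -
    obtain e where e: "e > 0" "cball z e \<subseteq> \<Omega>"
      using z assms(1) open_contains_cball by blast
    let ?t = "e / norm h"
    have t: "?t > 0" using e h by simp
    have "z - ?t *\<^sub>R h \<in> \<Omega>" using e h by (intro subsetD[OF e(2)]) (simp add: dist_norm)
    then have "0 \<le> inner h (z - ?t *\<^sub>R h - \<xi>)" by (rule h)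
    also have "\<dots> = inner h (z - \<xi>) - ?t * inner h h"
      by (simp add: inner_diff_right)
    finally have "?t * inner h h \<le> inner h (z - \<xi>)" by simp
    moreover have "?t * inner h h > 0" using t h by (intro mult_pos_pos) auto
    ultimately show ?thesis by linarith
  qed
  then show ?thesis unfolding inn by blast
qed

lemma norm_exp_minus_1_le: "cmod (exp u - 1) \<le> cmod u * exp (cmod u)"
proof -
  have "cmod (exp u - exp 0) \<le> exp (cmod u) * cmod (u - 0)"
  proof (rule field_differentiable_bound[of "cball 0 (cmod u)"])
    show "(exp has_field_derivative exp z) (at z within cball 0 (cmod u))" for z :: complex
      by (auto intro!: derivative_eq_intros)
    show "cmod (exp z) \<le> exp (cmod u)" if "z \<in> cball 0 (cmod u)" for z
      using norm_exp[of z] that by (simp add: order_trans[OF complex_Re_le_cmod])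
  qed auto
  then show ?thesis by (simp add: mult.commute)
qed

definition kobayashi_modulus :: "real \<Rightarrow> real" where
  "kobayashi_modulus \<kappa> = 2 * (4 * exp pi * \<kappa>) * exp (4 * exp pi * \<kappa>)"

lemma kobayashi_modulus_pos: "\<kappa> > 0 \<Longrightarrow> kobayashi_modulus \<kappa> > 0"
  by (simp add: kobayashi_modulus_def)

lemma disc_in_of_kobayashi_dist_le:
  fixes \<Omega> :: "(complex ^ 'd) set"
  assumes "open \<Omega>" "convex \<Omega>" and pq: "p \<in> \<Omega>" "q \<in> \<Omega>"
    and chain: "disc_chain \<Omega> p q n0 p0 f0 a0 b0"
    and le: "kobayashi_dist \<Omega> p q \<le> \<kappa>" and \<kappa>: "\<kappa> > 0"
  shows "disc_in \<Omega> p ((1 / kobayashi_modulus \<kappa>) *\<^sub>R (q - p))"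
proof (rule ccontr)
  define c where "c = 1 / kobayashi_modulus \<kappa>"
  have c: "c > 0" using kobayashi_modulus_pos[OF \<kappa>] by (simp add: c_def)
  assume "\<not> disc_in \<Omega> p ((1 / kobayashi_modulus \<kappa>) *\<^sub>R (q - p))"
  then obtain \<zeta> where \<zeta>: "cmod \<zeta> \<le> 1" and "p + \<zeta> *s (c *\<^sub>R (q - p)) \<notin> closure \<Omega>"
    unfolding disc_in_def c_def by auto
  then have "p + (\<zeta> * of_real c) *s (q - p) \<notin> \<Omega>"
    using closure_subset[of \<Omega>]
    by (metis of_real_vector_smult subsetD vector_smult_assoc)
  then obtain \<xi> where \<xi>: "\<xi> \<notin> \<Omega>" "\<xi> = p + (\<zeta> * of_real c) *s (q - p)" by blast
  obtain h where h: "\<And>z. z \<in> \<Omega> \<Longrightarrow> 0 < Re (\<Sum>i\<in>UNIV. cnj (h $ i) * (z $ i - \<xi> $ i))"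
    using complex_supporting_functional[OF assms(1,2) \<xi>(1)] by blast
  define f where "f z = (\<Sum>i\<in>UNIV. cnj (h $ i) * (z $ i - \<xi> $ i))" for z
  have fpos: "0 < Re (f z)" if "z \<in> \<Omega>" for z using h[OF that] by (simp add: f_def)
  define L where "L = (\<Sum>i\<in>UNIV. cnj (h $ i) * (q $ i - p $ i))"
  have fp: "f p = - (\<zeta> * of_real c) * L"
    by (simp add: f_def L_def \<xi>(2) sum_distrib_left sum_negf[symmetric] algebra_simps)
  have fq: "f q = f p + L"
    unfolding f_def L_def by (simp add: sum.distrib[symmetric] algebra_simps)
  have fp0: "f p \<noteq> 0" and fq0: "f q \<noteq> 0"
    using fpos[OF pq(1)] fpos[OF pq(2)] by auto
  then have nz: "\<zeta> \<noteq> 0" "L \<noteq> 0" "c \<noteq> 0" using fp by auto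
  have lip: "cmod (Ln (f p) - Ln (f q)) \<le> 4 * exp pi * kobayashi_dist \<Omega> p q"
  proof (rule kobayashi_dist_lower[where g = "\<lambda>z. Ln (f z)", OF _ _ chain])
    fix \<phi> :: "complex \<Rightarrow> complex ^ 'd"
    assume \<phi>: "holomorphic_map_on \<phi> (ball 0 1)" "\<phi> ` ball 0 1 \<subseteq> \<Omega>"
    have hf: "(\<lambda>z. f (\<phi> z)) holomorphic_on ball 0 1"
      unfolding f_def using \<phi>(1) by (intro holomorphic_intros) (simp add: holomorphic_map_on_def)
    show "(\<lambda>z. Ln (f (\<phi> z))) holomorphic_on ball 0 1"
    proof (rule holomorphic_on_Ln'[OF _ hf])
      fix z :: complex assume "z \<in> ball 0 1"
      then have "0 < Re (f (\<phi> z))" using \<phi>(2) by (intro fpos) auto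
      then show "f (\<phi> z) \<notin> \<real>\<^sub>\<le>\<^sub>0" by (auto simp: complex_nonpos_Reals_iff)
    qed
  next
    fix x assume "x \<in> \<Omega>"
    then show "\<bar>Im (Ln (f x))\<bar> < pi / 2"
      using fpos[of x] Re_Ln_pos_lt_imp by blast
  qed
  define u where "u = Ln (f q) - Ln (f p)"
  have "exp u = f q / f p" using fp0 fq0 by (simp add: u_def exp_diff)
  also have "\<dots> = 1 - 1 / (\<zeta> * of_real c)"
    using nz by (simp add: fq fp field_simps)
  finally have "cmod (exp u - 1) = 1 / (cmod \<zeta> * c)"
    using c by (simp add: norm_divide norm_mult)
  moreover have "1 / (cmod \<zeta> * c) \<ge> 1 / c"
    using c \<zeta> nz by (simp add: field_simps)
  moreover have "cmod u \<le> 4 * exp pi * \<kappa>"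
  proof -
    have "cmod u \<le> 4 * exp pi * kobayashi_dist \<Omega> p q"
      using lip by (simp add: u_def norm_minus_commute)
    also have "\<dots> \<le> 4 * exp pi * \<kappa>" using le by simp
    finally show ?thesis .
  qed
  moreover then have "cmod u * exp (cmod u) \<le> (4 * exp pi * \<kappa>) * exp (4 * exp pi * \<kappa>)"
    using \<kappa> by (intro mult_mono) auto
  moreover have "1 / c = 2 * ((4 * exp pi * \<kappa>) * exp (4 * exp pi * \<kappa>))"
    by (simp add: c_def kobayashi_modulus_def)
  moreover have "(4 * exp pi * \<kappa>) * exp (4 * exp pi * \<kappa>) > 0" using \<kappa> by simp
  ultimately show False using norm_exp_minus_1_le[of u] by linarith
qed

lemma affine_disc_in_ball:
  assumes "0 < r" "2 * norm (y - x) \<le> r" "ball x r \<subseteq> \<Omega>"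
  shows "holomorphic_map_on (\<lambda>z. x + z *s (2 *\<^sub>R (y - x))) (ball 0 1)"
    "(\<lambda>z. x + z *s (2 *\<^sub>R (y - x))) ` ball 0 1 \<subseteq> \<Omega>"
    "x + (1/2) *s (2 *\<^sub>R (y - x)) = y"
proof -
  show "holomorphic_map_on (\<lambda>z. x + z *s (2 *\<^sub>R (y - x))) (ball 0 1)"
    unfolding holomorphic_map_on_def by (auto intro!: holomorphic_intros)
  have half: "(1/2 :: complex) = of_real (1/2)" by simp
  show "x + (1/2) *s (2 *\<^sub>R (y - x)) = y"
    unfolding half of_real_vector_smult by simp
  show "(\<lambda>z. x + z *s (2 *\<^sub>R (y - x))) ` ball 0 1 \<subseteq> \<Omega>"
  proof -
    have "x + z *s (2 *\<^sub>R (y - x)) \<in> ball x r" if "cmod z < 1" for z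
    proof (cases "y = x")
      case False
      have "cmod z * (2 * norm (y - x)) < 1 * (2 * norm (y - x))"
        using that False by (intro mult_strict_right_mono) auto
      then show ?thesis using assms by (simp add: dist_norm norm_vector_smult)
    qed (use assms in auto)
    then show ?thesis using assms by auto
  qed
qed

lemma ball_convex_combination_subset:
  fixes \<Omega> :: "'a::real_normed_vector set"
  assumes "convex \<Omega>" "p \<in> \<Omega>" "ball a \<rho> \<subseteq> \<Omega>" "0 \<le> t" "t \<le> 1"
  shows "ball (p + t *\<^sub>R (a - p)) (t * \<rho>) \<subseteq> \<Omega>"
proof
  fix y assume y: "y \<in> ball (p + t *\<^sub>R (a - p)) (t * \<rho>)"
  then have "t \<noteq> 0" by auto
  then have t: "t > 0" using assms by simp
  define b where "b = a + (1 / t) *\<^sub>R (y - (p + t *\<^sub>R (a - p)))"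
  have "b \<in> ball a \<rho>"
  proof -
    have "norm (b - a) = norm (y - (p + t *\<^sub>R (a - p))) / t"
      using t by (simp add: b_def)
    also have "\<dots> < \<rho>"
      using y t by (simp add: dist_norm norm_minus_commute pos_divide_less_eq mult.commute)
    finally show ?thesis by (simp add: dist_norm norm_minus_commute)
  qed
  then have "b \<in> \<Omega>" using assms by auto
  then have "(1 - t) *\<^sub>R p + t *\<^sub>R b \<in> \<Omega>"
    using assms by (intro convexD_alt) auto
  moreover have "(1 - t) *\<^sub>R p + t *\<^sub>R b = y"
    using t by (simp add: b_def algebra_simps)
  ultimately show "y \<in> \<Omega>" by simp
qed

text \<open>The chain approaches \<open>p\<close> geometrically along the segment from \<open>a\<close>, which keeps the ratio of
  step length to distance from the boundary bounded.\<close>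

lemma disc_chain_exists:
  fixes \<Omega> :: "(complex ^ 'd) set"
  assumes "convex \<Omega>" "\<rho> > 0" "ball a \<rho> \<subseteq> \<Omega>" "\<delta> > 0" "ball p \<delta> \<subseteq> \<Omega>"
    and R: "norm (a - p) \<le> R" and q: "0 < q" "q < 1" "2 * q * R \<le> \<rho>"
    and N: "2 * (1 - q) ^ N * R \<le> \<delta>"
  shows "\<exists>ps f \<alpha> \<beta>. disc_chain \<Omega> a p (Suc N) ps f \<alpha> \<beta> \<and>
    (\<Sum>i<Suc N. poincare_dist (\<alpha> i) (\<beta> i)) = real (Suc N) * artanh (1/2)"
proof -
  define x where "x j = p + (1 - q) ^ j *\<^sub>R (a - p)" for j
  define ps where "ps j = (if j \<le> N then x j else p)" for j
  define f where "f j z = (if j < N then x j + z *s (2 *\<^sub>R (x (Suc j) - x j))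
      else p + z *s (2 *\<^sub>R (x N - p)))" for j z
  define \<alpha> :: "nat \<Rightarrow> complex" where "\<alpha> j = (if j < N then 0 else 1/2)" for j
  define \<beta> :: "nat \<Rightarrow> complex" where "\<beta> j = (if j < N then 1/2 else 0)" for j
  have p: "p \<in> \<Omega>" using assms by auto
  have xb: "ball (x j) ((1 - q) ^ j * \<rho>) \<subseteq> \<Omega>" for j
    unfolding x_def using q assms p by (intro ball_convex_combination_subset) (auto simp: power_le_one)
  have step: "2 * norm (x (Suc j) - x j) \<le> (1 - q) ^ j * \<rho>" for j
  proof -
    have "x (Suc j) - x j = (- q * (1 - q) ^ j) *\<^sub>R (a - p)"
      by (simp add: x_def algebra_simps)
    then have "2 * norm (x (Suc j) - x j) = (1 - q) ^ j * (2 * q * norm (a - p))"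
      using q by (simp add: abs_mult)
    also have "\<dots> \<le> (1 - q) ^ j * (2 * q * R)"
      using q R by (intro mult_left_mono) auto
    also have "\<dots> \<le> (1 - q) ^ j * \<rho>" using q by (intro mult_left_mono) auto
    finally show ?thesis .
  qed
  have last: "2 * norm (x N - p) \<le> \<delta>"
  proof -
    have "2 * norm (x N - p) = 2 * (1 - q) ^ N * norm (a - p)" using q by (simp add: x_def)
    also have "\<dots> \<le> 2 * (1 - q) ^ N * R" using R q by (intro mult_left_mono) auto
    finally show ?thesis using N by simp
  qed
  have "disc_chain \<Omega> a p (Suc N) ps f \<alpha> \<beta>"
    unfolding disc_chain_def
  proof (intro conjI allI impI)
    show "ps 0 = a" by (simp add: ps_def x_def)
    fix i assume i: "i < Suc N"
    have "0 < (1 - q) ^ i * \<rho>" using q assms by simp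
    note A = affine_disc_in_ball[OF this step xb] affine_disc_in_ball[OF assms(4) last assms(5)]
    show "holomorphic_map_on (f i) (ball 0 1)" "f i ` ball 0 1 \<subseteq> \<Omega>"
      using A by (cases "i < N"; simp add: f_def[abs_def])+
    show "\<alpha> i \<in> ball 0 1" "\<beta> i \<in> ball 0 1" by (auto simp: \<alpha>_def \<beta>_def)
    show "f i (\<alpha> i) = ps i" "f i (\<beta> i) = ps (Suc i)"
      using A i by (auto simp: f_def \<alpha>_def \<beta>_def ps_def less_Suc_eq)
  qed (simp add: ps_def)
  moreover have "poincare_dist (\<alpha> i) (\<beta> i) = artanh (1/2)" for i
    by (simp add: poincare_dist_def \<alpha>_def \<beta>_def)
  ultimately show ?thesis by (intro exI[of _ ps] exI[of _ f] exI[of _ \<alpha>] exI[of _ \<beta>]) simp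
qed

lemma disc_chain_in_domain:
  fixes \<Omega> :: "(complex ^ 'd) set"
  assumes "open \<Omega>" "convex \<Omega>" "a \<in> \<Omega>" "p \<in> \<Omega>"
  shows "\<exists>n ps f \<alpha> \<beta>. disc_chain \<Omega> a p n ps f \<alpha> \<beta>"
proof -
  obtain \<rho> where \<rho>: "\<rho> > 0" "ball a \<rho> \<subseteq> \<Omega>" using assms open_contains_ball by blast
  obtain \<delta> where \<delta>: "\<delta> > 0" "ball p \<delta> \<subseteq> \<Omega>" using assms open_contains_ball by blast
  define R where "R = norm (a - p) + \<rho>"
  have R: "R > 0" using \<rho> by (simp add: R_def add_nonneg_pos)
  define q where "q = \<rho> / (2 * R)"
  have q: "0 < q" "q < 1" "2 * q * R \<le> \<rho>"
  proof -
    show "0 < q" "2 * q * R \<le> \<rho>" using \<rho> R by (auto simp: q_def)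
    have "\<rho> \<le> R" by (simp add: R_def)
    then have "\<rho> < 2 * R" using R by linarith
    then show "q < 1" using R by (simp add: q_def)
  qed
  obtain N where "(1 - q) ^ N < \<delta> / (2 * R)"
    using real_arch_pow_inv[of "\<delta> / (2 * R)" "1 - q"] \<delta> R q by auto
  then have "2 * (1 - q) ^ N * R \<le> \<delta>" using R by (simp add: field_simps)
  moreover have "norm (a - p) \<le> R" using \<rho> by (simp add: R_def)
  ultimately show ?thesis
    using disc_chain_exists[OF assms(2) \<rho> \<delta> _ q] by blast
qed

subsection \<open>Normalisation at a point\<close>

lemma compact_subsequence:
  fixes S :: "'a::first_countable_topology set"
  assumes "compact S" "\<forall>n. f n \<in> S"
  obtains l r where "l \<in> S" "strict_mono (r :: nat \<Rightarrow> nat)" "(f \<circ> r) \<longlonglongrightarrow> l"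
  using compact_imp_seq_compact[OF assms(1)] assms(2) by (rule seq_compactE)

lemma open_convex_interior_closure:
  fixes \<Omega> :: "'a::euclidean_space set"
  assumes "open \<Omega>" "convex \<Omega>"
  shows "interior (closure \<Omega>) = \<Omega>"
  using assms by (simp add: convex_interior_closure interior_open)

lemma no_complex_line_in_closure:
  fixes \<Omega> :: "(complex ^ 'd) set"
  assumes "C_properly_convex \<Omega>" "\<Omega> \<noteq> {}" and line: "\<And>z. p + z *s v \<in> closure \<Omega>"
  shows "v = 0"
proof (rule ccontr)
  assume "v \<noteq> 0"
  obtain q where q: "q \<in> \<Omega>" using assms by blast
  have \<Omega>: "open \<Omega>" "convex \<Omega>" using assms by (auto simp: C_properly_convex_def)
  have "(1/2) *\<^sub>R (p + q) + z *s v \<in> \<Omega>" for z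
  proof -
    let ?x = "p + (2 * z) *s v"
    have "?x - (1/2) *\<^sub>R (?x - q) \<in> interior \<Omega>"
      using \<Omega> q line by (intro mem_interior_closure_convex_shrink) (auto simp: interior_open)
    moreover have "?x - (1/2) *\<^sub>R (?x - q) = (1/2) *\<^sub>R (p + q) + z *s v"
      by (simp add: vec_eq_iff algebra_simps scaleR_conv_of_real[where 'a = complex])
    ultimately show ?thesis using \<Omega> by (simp add: interior_open)
  qed
  then show False using assms(1) \<open>v \<noteq> 0\<close> unfolding C_properly_convex_def by blast
qed

lemma disc_in_bounded:
  fixes \<Omega> :: "(complex ^ 'd) set"
  assumes "C_properly_convex \<Omega>" "\<Omega> \<noteq> {}"
  shows "\<exists>b>0. \<forall>p\<in>closure \<Omega> \<inter> cball 0 R. \<forall>w. disc_in \<Omega> p w \<longrightarrow> norm w \<le> b"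
proof (rule ccontr)
  assume neg: "\<not> ?thesis"
  have "\<exists>p w. p \<in> closure \<Omega> \<inter> cball 0 R \<and> disc_in \<Omega> p w \<and> norm w > real n + 1" for n :: nat
  proof (rule ccontr)
    assume *: "\<not> (\<exists>p w. p \<in> closure \<Omega> \<inter> cball 0 R \<and> disc_in \<Omega> p w \<and> norm w > real n + 1)"
    have "\<exists>b>0. \<forall>p\<in>closure \<Omega> \<inter> cball 0 R. \<forall>w. disc_in \<Omega> p w \<longrightarrow> norm w \<le> b"
      by (rule exI[of _ "real n + 1"]) (use * in \<open>auto simp: not_less\<close>)
    then show False using neg by blast
  qed
  then obtain P W where P: "\<And>n. P n \<in> closure \<Omega> \<inter> cball 0 R"
    and W: "\<And>n. disc_in \<Omega> (P n) (W n)" "\<And>n::nat. norm (W n) > real n + 1"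
    by metis
  have nW: "norm (W n) > 0" for n using W(2)[of n] by linarith
  define v where "v n = (1 / norm (W n)) *\<^sub>R W n" for n
  have "compact ((closure \<Omega> \<inter> cball 0 R) \<times> sphere (0 :: complex ^ 'd) 1)"
    by (intro compact_Times closed_Int_compact) auto
  moreover have "\<forall>n. (P n, v n) \<in> (closure \<Omega> \<inter> cball 0 R) \<times> sphere 0 1"
    using P nW by (auto simp: v_def)
  ultimately obtain l r where l: "l \<in> (closure \<Omega> \<inter> cball 0 R) \<times> sphere (0 :: complex ^ 'd) 1"
    and r: "strict_mono r" and lim: "((\<lambda>n. (P n, v n)) \<circ> r) \<longlonglongrightarrow> l"
    by (rule compact_subsequence)
  obtain p u where pu: "l = (p, u)" by (cases l)
  have limP: "(\<lambda>n. P (r n)) \<longlonglongrightarrow> p" and limv: "(\<lambda>n. v (r n)) \<longlonglongrightarrow> u"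
    using tendsto_fst[OF lim] tendsto_snd[OF lim] by (simp_all add: pu o_def)
  have "p + z *s u \<in> closure \<Omega>" for z
  proof (rule Lim_in_closed_set)
    show "(\<lambda>n. P (r n) + z *s v (r n)) \<longlonglongrightarrow> p + z *s u"
      by (intro tendsto_intros limP limv)
    have "eventually (\<lambda>n. n \<ge> nat \<lceil>cmod z\<rceil>) sequentially" by (rule eventually_ge_at_top)
    then show "\<forall>\<^sub>F n in sequentially. P (r n) + z *s v (r n) \<in> closure \<Omega>"
    proof eventually_elim
      case (elim n)
      have "cmod z \<le> real n" using elim by linarith
      also have "\<dots> \<le> real (r n)" using seq_suble[OF r, of n] by simp
      also have "\<dots> \<le> norm (W (r n))" using W(2)[of "r n"] by linarith
      finally have "cmod (z * of_real (1 / norm (W (r n)))) \<le> 1"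
        using nW[of "r n"] by (simp add: norm_mult norm_divide field_simps)
      then have "P (r n) + (z * of_real (1 / norm (W (r n)))) *s W (r n) \<in> closure \<Omega>"
        using W(1)[of "r n"] unfolding disc_in_def by blast
      moreover have "(z * of_real (1 / norm (W (r n)))) *s W (r n) = z *s v (r n)"
        unfolding v_def by (simp only: of_real_vector_smult[symmetric] vector_smult_assoc)
      ultimately show ?case by simp
    qed
  qed auto
  then have "u = 0" by (rule no_complex_line_in_closure[OF assms])
  then show False using l pu by simp
qed

lemma closed_disc_in: "closed {w. disc_in \<Omega> p w}"
proof -
  have "closed ((\<lambda>w. p + \<zeta> *s w) -` closure \<Omega>)" for \<zeta>
    by (intro closed_vimage continuous_intros closed_closure)
  then have "closed (\<Inter>\<zeta>\<in>{\<zeta>. cmod \<zeta> \<le> 1}. (\<lambda>w. p + \<zeta> *s w) -` closure \<Omega>)" by blast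
  moreover have "(\<Inter>\<zeta>\<in>{\<zeta>. cmod \<zeta> \<le> 1}. (\<lambda>w. p + \<zeta> *s w) -` closure \<Omega>) = {w. disc_in \<Omega> p w}"
    by (auto simp: disc_in_def)
  ultimately show ?thesis by simp
qed

lemma norm_vec_le_sum: "norm x \<le> (\<Sum>i\<in>UNIV. norm (x $ i))"
  by (simp add: norm_vec_def L2_set_le_sum)

text \<open>An Auerbach basis of the balanced core \<open>{w. disc_in \<Omega> p w}\<close>: the rows of a matrix of maximal
  determinant, so that Cramer's rule bounds the coordinates of the core by \<open>1\<close>.\<close>

lemma balanced_normalization:
  fixes \<Omega> :: "(complex ^ 'd) set"
  assumes C: "C_properly_convex \<Omega>" and p: "p \<in> \<Omega>"
  obtains B M :: "complex ^ 'd ^ 'd" where "B ** M = mat 1" "M ** B = mat 1"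
    "\<And>w. disc_in \<Omega> p w \<Longrightarrow> norm (B *v w) \<le> CARD('d)"
    "\<And>u. norm u \<le> 1 / CARD('d) \<Longrightarrow> p + M *v u \<in> closure \<Omega>"
proof -
  have \<Omega>: "open \<Omega>" "convex \<Omega>" "\<Omega> \<noteq> {}" using C p by (auto simp: C_properly_convex_def)
  define S where "S = {w. disc_in \<Omega> p w}"
  have "p \<in> closure \<Omega> \<inter> cball 0 (norm p)" using p closure_subset[of \<Omega>] by auto
  then obtain b where b: "\<And>w. w \<in> S \<Longrightarrow> norm w \<le> b"
    using disc_in_bounded[OF C \<Omega>(3), of "norm p"] unfolding S_def by blast
  define T :: "(complex ^ 'd ^ 'd) set" where "T = {A. \<forall>i. A $ i \<in> S}"
  have "T = (\<Inter>i. (\<lambda>A. A $ i) -` S)" by (auto simp: T_def)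
  moreover have "closed ((\<lambda>A :: complex ^ 'd ^ 'd. A $ i) -` S)" for i
    unfolding S_def by (intro closed_vimage closed_disc_in linear_continuous_on bounded_linear_vec_nth)
  ultimately have "closed T" by auto
  moreover have "bounded T"
  proof -
    have "norm A \<le> CARD('d) * b" if "A \<in> T" for A
    proof -
      have "norm A \<le> (\<Sum>i\<in>UNIV. norm (A $ i))" by (rule norm_vec_le_sum)
      also have "\<dots> \<le> (\<Sum>i\<in>(UNIV::'d set). b)"
        using that b by (intro sum_mono) (auto simp: T_def)
      finally show ?thesis by simp
    qed
    then show ?thesis unfolding bounded_iff by blast
  qed
  ultimately have "compact T" by (simp add: compact_eq_bounded_closed)
  obtain e where e: "e > 0" "cball p e \<subseteq> \<Omega>"
    using \<Omega> p open_contains_cball by blast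
  define D0 :: "complex ^ 'd ^ 'd" where "D0 = (\<chi> i j. if i = j then of_real e else 0)"
  have D0: "D0 \<in> T"
    unfolding T_def S_def disc_in_def
  proof (intro CollectI allI impI)
    fix i and \<zeta> :: complex assume \<zeta>: "cmod \<zeta> \<le> 1"
    have "D0 $ i = of_real e *s axis i 1" by (auto simp: D0_def vec_eq_iff axis_def)
    then have "norm (\<zeta> *s D0 $ i) \<le> 1 * (e * 1)"
      using \<zeta> e by (simp add: norm_vector_smult norm_mult mult_left_le_one_le)
    then have "p + \<zeta> *s D0 $ i \<in> cball p e" by (simp add: dist_norm)
    then show "p + \<zeta> *s D0 $ i \<in> closure \<Omega>" using e closure_subset by blast
  qed
  have "det D0 = (\<Prod>i\<in>(UNIV::'d set). D0 $ i $ i)" by (rule det_diagonal) (simp add: D0_def)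
  then have detD0: "det D0 \<noteq> 0" using e by (simp add: D0_def)
  have "continuous_on T (\<lambda>A. cmod (det A))"
    unfolding det_def by (intro continuous_intros)
  then obtain A where A: "A \<in> T" and max: "\<And>A'. A' \<in> T \<Longrightarrow> cmod (det A') \<le> cmod (det A)"
    using continuous_attains_sup[OF \<open>compact T\<close>] D0 by blast
  have detA: "det A \<noteq> 0" using max[OF D0] detD0 by auto
  define M where "M = transpose A"
  have detM: "det M \<noteq> 0" "det M = det A" using detA by (auto simp: M_def)
  then obtain B where B: "M ** B = mat 1" "B ** M = mat 1"
    by (metis invertible_def invertible_det_nz)
  show ?thesis
  proof (rule that[OF B(2) B(1)])
    fix w assume w: "disc_in \<Omega> p w"
    have Mx: "M *v (B *v w) = w" by (simp add: matrix_vector_mul_assoc B)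
    have "cmod ((B *v w) $ k) \<le> 1" for k
    proof -
      define N :: "complex ^ 'd ^ 'd" where
        "N = (\<chi> i j. if j = k then (M *v (B *v w)) $ i else M $ i $ j)"
      have MA: "M $ i $ j = A $ j $ i" for i j by (simp add: M_def transpose_def)
      have tN: "transpose N $ j = (if j = k then w else A $ j)" for j
        unfolding N_def by (simp only: vec_eq_iff transpose_def vec_lambda_beta Mx MA) simp
      have "transpose N $ j \<in> S" for j
        unfolding tN using A w by (simp add: T_def S_def)
      then have "transpose N \<in> T" unfolding T_def by blast
      from max[OF this] have "cmod (det N) \<le> cmod (det M)" by (simp only: det_transpose detM(2))
      then have "cmod ((B *v w) $ k) * cmod (det M) \<le> 1 * cmod (det M)"
        unfolding N_def by (simp only: cramer_lemma norm_mult mult_1)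
      then show ?thesis using detM(1) by (meson mult_right_le_imp_le zero_less_norm_iff)
    qed
    then have "(\<Sum>i\<in>UNIV. cmod ((B *v w) $ i)) \<le> (\<Sum>i\<in>(UNIV::'d set). 1)" by (intro sum_mono)
    then show "norm (B *v w) \<le> CARD('d)"
      using norm_vec_le_sum[of "B *v w"] by simp
  next
    fix u :: "complex ^ 'd" assume u: "norm u \<le> 1 / CARD('d)"
    let ?d = "real CARD('d)"
    have d: "?d > 0" by simp
    have "(\<Sum>j\<in>(UNIV::'d set). (1 / ?d) *\<^sub>R (p + (of_real ?d * u $ j) *s A $ j)) \<in> closure \<Omega>"
    proof (rule convex_sum)
      fix j
      have "cmod (u $ j) \<le> 1 / ?d" using u Finite_Cartesian_Product.norm_nth_le[of u j] by linarith
      then have "cmod (of_real ?d * u $ j) \<le> 1" using d by (simp add: norm_mult field_simps)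
      then show "p + (of_real ?d * u $ j) *s A $ j \<in> closure \<Omega>"
        using A unfolding T_def S_def disc_in_def by blast
    qed (use \<Omega> in \<open>auto intro: convex_closure\<close>)
    also have "(\<Sum>j\<in>(UNIV::'d set). (1 / ?d) *\<^sub>R (p + (of_real ?d * u $ j) *s A $ j)) = p + M *v u"
    proof -
      have "(1 / ?d) *\<^sub>R ((of_real ?d * u $ j) *s A $ j) = u $ j *s A $ j" for j
        using d by (simp add: vec_eq_iff scaleR_conv_of_real[where 'a = complex])
      moreover have "M *v u = (\<Sum>j\<in>UNIV. u $ j *s A $ j)"
        by (simp add: vec_eq_iff matrix_vector_mult_def M_def transpose_def mult.commute)
      moreover have "(\<Sum>j\<in>(UNIV::'d set). (1 / ?d) *\<^sub>R p) = p"
        by (simp only: sum_constant_scaleR) simp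
      ultimately show ?thesis
        by (simp only: scaleR_right_distrib sum.distrib)
    qed
    finally show "p + M *v u \<in> closure \<Omega>" .
  qed
qed

subsection \<open>Compactness in the local Hausdorff topology\<close>

lemma infdist_convergent_subsequence:
  fixes F :: "nat \<Rightarrow> 'a::euclidean_space set"
  assumes "\<And>n. 0 \<in> F n"
  obtains r :: "nat \<Rightarrow> nat" where "strict_mono r" "\<And>x. convergent (\<lambda>n. infdist x (F (r n)))"
proof -
  obtain Q :: "'a set" where Q: "countable Q" "\<And>X. open X \<Longrightarrow> X \<noteq> {} \<Longrightarrow> \<exists>d\<in>Q. d \<in> X"
    using countable_dense_exists by blast
  have le: "infdist x (F n) \<le> norm x" for n x
    using infdist_le[OF assms(1)[of n], of x] by simp
  have pos: "0 < 1 + norm x" for x :: 'a using norm_ge_zero[of x] by linarith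
  have "norm (infdist x (F n) / (1 + norm x)) \<le> 1" for n x
    using le[of x n] infdist_nonneg[of x "F n"] pos[of x] by simp
  then obtain r where r: "strict_mono (r :: nat \<Rightarrow> nat)"
      "\<And>x. x \<in> Q \<Longrightarrow> \<exists>l. (\<lambda>n. infdist x (F (r n)) / (1 + norm x)) \<longlonglongrightarrow> l"
    using function_convergent_subsequence[OF Q(1), of "\<lambda>n x. infdist x (F n) / (1 + norm x)" 1] by blast
  have conv: "convergent (\<lambda>n. infdist x (F (r n)))" if xQ: "x \<in> Q" for x
  proof -
    obtain l where "(\<lambda>n. infdist x (F (r n)) / (1 + norm x)) \<longlonglongrightarrow> l" using r(2)[OF xQ] by blast
    then have "(\<lambda>n. infdist x (F (r n)) / (1 + norm x) * (1 + norm x)) \<longlonglongrightarrow> l * (1 + norm x)"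
      by (intro tendsto_intros)
    then show ?thesis using pos[of x] by (auto simp: convergent_def)
  qed
  have "Cauchy (\<lambda>n. infdist x (F (r n)))" for x
  proof (rule CauchyI)
    fix e :: real assume e: "e > 0"
    obtain q where q: "q \<in> Q" "q \<in> ball x (e / 3)" using Q(2)[of "ball x (e / 3)"] e by auto
    obtain N where N: "\<And>m n. m \<ge> N \<Longrightarrow> n \<ge> N \<Longrightarrow> norm (infdist q (F (r m)) - infdist q (F (r n))) < e / 3"
      using CauchyD[OF convergent_Cauchy[OF conv[OF q(1)]], of "e / 3"] e by auto
    have "norm (infdist x (F (r m)) - infdist x (F (r n))) < e" if "m \<ge> N" "n \<ge> N" for m n
      using N[OF that] infdist_triangle_abs[of x "F (r m)" q] infdist_triangle_abs[of x "F (r n)" q] q(2)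
      unfolding real_norm_def mem_ball by linarith
    then show "\<exists>M. \<forall>m\<ge>M. \<forall>n\<ge>M. norm (infdist x (F (r m)) - infdist x (F (r n))) < e" by blast
  qed
  then show ?thesis using that[OF r(1)] Cauchy_convergent by blast
qed

lemma hausdorff_distance_le:
  assumes "\<And>a. a \<in> A \<Longrightarrow> \<exists>b\<in>B. dist a b \<le> e" "\<And>b. b \<in> B \<Longrightarrow> \<exists>a\<in>A. dist a b \<le> e"
  shows "hausdorff_distance A B \<le> ennreal e"
  unfolding hausdorff_distance_def
proof (intro max.boundedI SUP_least)
  fix a assume "a \<in> A"
  then obtain b where "b \<in> B" "dist a b \<le> e" using assms(1) by blast
  then show "(INF b\<in>B. ennreal (dist a b)) \<le> ennreal e"
    by (intro INF_lower2[of b]) (auto intro: ennreal_leI)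
next
  fix b assume "b \<in> B"
  then obtain a where "a \<in> A" "dist a b \<le> e" using assms(2) by blast
  then show "(INF a\<in>A. ennreal (dist a b)) \<le> ennreal e"
    by (intro INF_lower2[of a]) (auto intro: ennreal_leI)
qed

lemma hausdorff_distance_tendsto_0:
  assumes "\<And>e. e > 0 \<Longrightarrow> \<forall>\<^sub>F n in F. (\<forall>a\<in>A n. \<exists>b\<in>B. dist a b \<le> e) \<and> (\<forall>b\<in>B. \<exists>a\<in>A n. dist a b \<le> e)"
  shows "((\<lambda>n. hausdorff_distance (A n) B) \<longlongrightarrow> 0) F"
proof (rule order_tendstoI)
  fix a :: ennreal assume "0 < a"
  then obtain c where c: "0 < c" "c < a" using dense by blast
  then have "c \<noteq> top" by auto
  define e where "e = enn2real c"
  have e: "e > 0" "ennreal e = c"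
    using c \<open>c \<noteq> top\<close> by (auto simp: e_def enn2real_positive_iff less_top)
  show "\<forall>\<^sub>F n in F. hausdorff_distance (A n) B < a"
    using assms[OF e(1)]
  proof eventually_elim
    case (elim n)
    then have "hausdorff_distance (A n) B \<le> ennreal e" by (intro hausdorff_distance_le) auto
    then show ?case using c e by simp
  qed
qed simp

locale converging_convex_sets =
  fixes F :: "nat \<Rightarrow> 'a::euclidean_space set" and c :: real
  assumes closed_F: "\<And>n. closed (F n)" and convex_F: "\<And>n. convex (F n)"
    and c_pos: "c > 0" and ball_F: "\<And>n. ball 0 c \<subseteq> F n"
    and conv_F: "\<And>x. convergent (\<lambda>n. infdist x (F n))"
begin

definition limit_set :: "'a set" where
  "limit_set = {x. (\<lambda>n. infdist x (F n)) \<longlonglongrightarrow> 0}"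

lemma zero_F: "0 \<in> F n"
  using ball_F[of n] c_pos by auto

lemma limit_setI:
  assumes s: "strict_mono (s :: nat \<Rightarrow> nat)" and x: "\<And>n. x n \<in> F (s n)" and lim: "x \<longlonglongrightarrow> y"
  shows "y \<in> limit_set"
proof -
  obtain l where l: "(\<lambda>n. infdist y (F n)) \<longlonglongrightarrow> l" using conv_F by (auto simp: convergent_def)
  have "(\<lambda>n. infdist y (F (s n))) \<longlonglongrightarrow> l"
    using LIMSEQ_subseq_LIMSEQ[OF l s] by (simp add: o_def)
  moreover have "(\<lambda>n. infdist y (F (s n))) \<longlonglongrightarrow> 0"
  proof (rule tendsto_sandwich[of "\<lambda>_. 0"])
    show "(\<lambda>n. dist y (x n)) \<longlonglongrightarrow> 0"
      using tendsto_dist[OF tendsto_const[of y] lim] by simp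
  qed (auto intro!: always_eventually infdist_le x infdist_nonneg)
  ultimately have "l = 0" by (rule LIMSEQ_unique)
  then show ?thesis using l by (simp add: limit_set_def)
qed

lemma limit_set_approx:
  assumes "y \<in> limit_set"
  obtains x where "\<And>n. x n \<in> F n" "x \<longlonglongrightarrow> y"
proof -
  have "\<exists>x\<in>F n. infdist y (F n) = dist y x" for n
    using infdist_attains_inf[OF closed_F, of n y] zero_F[of n] by blast
  then obtain x where x: "\<And>n. x n \<in> F n" "\<And>n. infdist y (F n) = dist y (x n)" by metis
  have "(\<lambda>n. dist y (x n)) \<longlonglongrightarrow> 0" using assms by (simp add: limit_set_def x(2)[symmetric])
  then have "(\<lambda>n. dist (x n) y) \<longlonglongrightarrow> 0" by (simp add: dist_commute)
  then have "x \<longlonglongrightarrow> y" by (rule tendsto_dist_iff[THEN iffD2])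
  then show ?thesis using that x by blast
qed

lemma convex_limit_set: "convex limit_set"
proof (rule convexI)
  fix x y and u v :: real assume xy: "x \<in> limit_set" "y \<in> limit_set" and uv: "0 \<le> u" "0 \<le> v" "u + v = 1"
  obtain X where X: "\<And>n. X n \<in> F n" "X \<longlonglongrightarrow> x" using limit_set_approx[OF xy(1)] by blast
  obtain Y where Y: "\<And>n. Y n \<in> F n" "Y \<longlonglongrightarrow> y" using limit_set_approx[OF xy(2)] by blast
  show "u *\<^sub>R x + v *\<^sub>R y \<in> limit_set"
  proof (rule limit_setI[of id])
    show "u *\<^sub>R X n + v *\<^sub>R Y n \<in> F (id n)" for n
      using convexD[OF convex_F X(1) Y(1) uv] by simp
    show "(\<lambda>n. u *\<^sub>R X n + v *\<^sub>R Y n) \<longlonglongrightarrow> u *\<^sub>R x + v *\<^sub>R y"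
      by (intro tendsto_intros X Y)
  qed (simp add: strict_mono_def)
qed

lemma ball_limit_set: "ball 0 c \<subseteq> limit_set"
proof
  fix x :: 'a assume "x \<in> ball 0 c"
  then show "x \<in> limit_set"
    by (intro limit_setI[of id "\<lambda>_. x"] subsetD[OF ball_F]) (auto simp: strict_mono_def)
qed

lemma closed_limit_set: "closed limit_set"
proof -
  have "x \<in> limit_set" if x: "x \<in> closure limit_set" for x
  proof -
    obtain l where l: "(\<lambda>n. infdist x (F n)) \<longlonglongrightarrow> l" using conv_F by (auto simp: convergent_def)
    have "l \<ge> 0" by (rule LIMSEQ_le_const[OF l]) (auto intro: infdist_nonneg)
    moreover have "l \<le> e" if e: "e > 0" for e
    proof -
      obtain y where y: "y \<in> limit_set" "dist y x < e" using x e closure_approachable by blast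
      have ly: "(\<lambda>n. infdist y (F n) + dist x y) \<longlonglongrightarrow> 0 + dist x y"
        using y by (intro tendsto_intros) (simp add: limit_set_def)
      have "l \<le> 0 + dist x y"
        by (rule LIMSEQ_le[OF l ly]) (auto intro: infdist_triangle)
      then show ?thesis using y by (simp add: dist_commute)
    qed
    ultimately have "l = 0" by (meson antisym dense_ge)
    then show ?thesis using l by (simp add: limit_set_def)
  qed
  then show ?thesis using closure_subset_eq by blast
qed

lemma zero_interior_limit_set: "0 \<in> interior limit_set"
  using ball_limit_set c_pos by (meson centre_in_ball interior_maximal open_ball subsetD)

lemma closure_interior_limit_set: "closure (interior limit_set) = limit_set"
  using convex_closure_interior[OF convex_limit_set] zero_interior_limit_set closed_limit_set by auto

text \<open>Otherwise the hyperplanes separating \<open>x n\<close> from the sets would converge to a hyperplane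
  supporting the limit set at its interior point \<open>y\<close>.\<close>

lemma eventually_mem_interior:
  assumes s: "strict_mono (s :: nat \<Rightarrow> nat)" and y: "y \<in> interior limit_set" and lim: "x \<longlonglongrightarrow> y"
  shows "\<forall>\<^sub>F n in sequentially. x n \<in> interior (F (s n))"
proof (rule ccontr)
  assume "\<not> ?thesis"
  then obtain t :: "nat \<Rightarrow> nat" where t: "strict_mono t" "\<And>n. x (t n) \<notin> interior (F (s (t n)))"
    using not_eventually_sequentiallyD by blast
  have "\<exists>h. norm h = 1 \<and> (\<forall>z\<in>F (s (t n)). 0 \<le> inner h (z - x (t n)))" for n
  proof -
    let ?G = "interior (F (s (t n)))"
    have "convex ((\<lambda>z. z - x (t n)) ` ?G)" "0 \<notin> (\<lambda>z. z - x (t n)) ` ?G"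
      using t(2)[of n] convex_interior[OF convex_F] by (auto simp: convex_translation_subtract_eq)
    from separating_hyperplane_set_0[OF this]
    obtain h where h: "h \<noteq> 0" "\<And>z. z \<in> ?G \<Longrightarrow> 0 \<le> inner h (z - x (t n))" by auto
    have "closed {z. inner h (x (t n)) \<le> inner h z}" by (rule closed_halfspace_ge)
    moreover have "?G \<subseteq> {z. inner h (x (t n)) \<le> inner h z}" using h(2) by (auto simp: inner_diff_right)
    ultimately have "closure ?G \<subseteq> {z. inner h (x (t n)) \<le> inner h z}" by (rule closure_minimal[rotated])
    moreover have "0 \<in> ?G"
      using ball_F c_pos by (meson centre_in_ball interior_maximal open_ball subsetD)
    then have "closure ?G = F (s (t n))"
      using convex_closure_interior[OF convex_F] closed_F by auto
    ultimately have "\<forall>z\<in>F (s (t n)). 0 \<le> inner h (z - x (t n))" by (auto simp: inner_diff_right)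
    then show ?thesis using h(1)
      by (intro exI[of _ "(1 / norm h) *\<^sub>R h"]) auto
  qed
  then obtain h where h: "\<And>n. norm (h n) = 1" "\<And>n z. z \<in> F (s (t n)) \<Longrightarrow> 0 \<le> inner (h n) (z - x (t n))"
    by metis
  have "\<forall>n. h n \<in> sphere 0 1" using h(1) by simp
  then obtain h0 k where h0: "h0 \<in> sphere 0 1" and k: "strict_mono (k :: nat \<Rightarrow> nat)" "(h \<circ> k) \<longlonglongrightarrow> h0"
    by (rule compact_subsequence[OF compact_sphere])
  obtain e where e: "e > 0" "cball y e \<subseteq> limit_set" using y by (meson mem_interior_cball)
  define z where "z = y - e *\<^sub>R h0"
  have "z \<in> limit_set" using e h0 by (intro subsetD[OF e(2)]) (simp add: z_def dist_norm)
  then obtain Z where Z: "\<And>n. Z n \<in> F n" "Z \<longlonglongrightarrow> z" using limit_set_approx by blast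
  have sub: "strict_mono (\<lambda>n. t (k n))" "strict_mono (\<lambda>n. s (t (k n)))"
    using s t(1) k(1) by (auto simp: strict_mono_def)
  have l1: "(\<lambda>n. Z (s (t (k n)))) \<longlonglongrightarrow> z" using LIMSEQ_subseq_LIMSEQ[OF Z(2) sub(2)] by (simp add: o_def)
  have l2: "(\<lambda>n. x (t (k n))) \<longlonglongrightarrow> y" using LIMSEQ_subseq_LIMSEQ[OF lim sub(1)] by (simp add: o_def)
  have "(\<lambda>n. inner (h (k n)) (Z (s (t (k n))) - x (t (k n)))) \<longlonglongrightarrow> inner h0 (z - y)"
    using k(2) by (intro tendsto_intros l1 l2) (simp add: o_def)
  then have "0 \<le> inner h0 (z - y)"
    by (rule LIMSEQ_le_const) (auto intro!: h(2) Z(1))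
  moreover have "inner h0 (z - y) = - e" using h0 by (simp add: z_def norm_eq_1)
  ultimately show False using e by simp
qed

lemma local_hausdorff_limit_set:
  assumes R: "R > 0"
  shows "(\<lambda>n. hausdorff_distance (F n \<inter> cball 0 R) (limit_set \<inter> cball 0 R)) \<longlonglongrightarrow> 0"
proof (rule hausdorff_distance_tendsto_0[where A = "\<lambda>n. F n \<inter> cball 0 R" and B = "limit_set \<inter> cball 0 R"])
  fix e :: real assume e: "e > 0"
  have 1: "\<forall>\<^sub>F n in sequentially. \<forall>a\<in>F n \<inter> cball 0 R. \<exists>b\<in>limit_set \<inter> cball 0 R. dist a b \<le> e"
  proof (rule ccontr)
    assume "\<not> ?thesis"
    from not_eventually_sequentiallyD[OF this] obtain t :: "nat \<Rightarrow> nat"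
      where t: "strict_mono t" "\<And>n. \<not> (\<forall>a\<in>F (t n) \<inter> cball 0 R. \<exists>b\<in>limit_set \<inter> cball 0 R. dist a b \<le> e)"
      by (elim exE conjE) blast
    have "\<exists>a. a \<in> F (t n) \<inter> cball 0 R \<and> (\<forall>b\<in>limit_set \<inter> cball 0 R. \<not> dist a b \<le> e)" for n
      using t(2)[of n] by blast
    then obtain a where a: "\<And>n. a n \<in> F (t n) \<inter> cball 0 R"
      "\<And>n b. b \<in> limit_set \<inter> cball 0 R \<Longrightarrow> \<not> dist (a n) b \<le> e" by metis
    have "\<forall>n. a n \<in> cball 0 R" using a(1) by simp
    then obtain y k where y: "y \<in> cball 0 R" and k: "strict_mono (k :: nat \<Rightarrow> nat)" "(a \<circ> k) \<longlonglongrightarrow> y"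
      by (rule compact_subsequence[OF compact_cball])
    have "y \<in> limit_set"
      by (rule limit_setI[of "\<lambda>n. t (k n)" "a \<circ> k"]) (use t k a in \<open>auto simp: strict_mono_def\<close>)
    then have "\<not> dist ((a \<circ> k) n) y \<le> e" for n using a(2) y by simp
    moreover have "\<forall>\<^sub>F n in sequentially. dist ((a \<circ> k) n) y < e" using k(2) e by (rule tendstoD)
    ultimately show False
      by (meson eventually_sequentially less_imp_le order_refl)
  qed
  have 2: "\<forall>\<^sub>F n in sequentially. \<forall>b\<in>limit_set \<inter> cball 0 R. \<exists>a\<in>F n \<inter> cball 0 R. dist a b \<le> e"
  proof (rule ccontr)
    assume "\<not> ?thesis"
    from not_eventually_sequentiallyD[OF this] obtain t :: "nat \<Rightarrow> nat"
      where t: "strict_mono t" "\<And>n. \<not> (\<forall>b\<in>limit_set \<inter> cball 0 R. \<exists>a\<in>F (t n) \<inter> cball 0 R. dist a b \<le> e)"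
      by (elim exE conjE) blast
    have "\<exists>b. b \<in> limit_set \<inter> cball 0 R \<and> (\<forall>a\<in>F (t n) \<inter> cball 0 R. \<not> dist a b \<le> e)" for n
      using t(2)[of n] by blast
    then obtain b where b: "\<And>n. b n \<in> limit_set \<inter> cball 0 R"
      "\<And>n a. a \<in> F (t n) \<inter> cball 0 R \<Longrightarrow> \<not> dist a (b n) \<le> e" by metis
    have "compact (limit_set \<inter> cball 0 R)" by (intro closed_Int_compact closed_limit_set compact_cball)
    then obtain y k where y: "y \<in> limit_set \<inter> cball 0 R" and k: "strict_mono (k :: nat \<Rightarrow> nat)" "(b \<circ> k) \<longlonglongrightarrow> y"
      by (rule compact_subsequence[OF _ allI[OF b(1)]])
    obtain x where x: "\<And>n. x n \<in> F n" "x \<longlonglongrightarrow> y" using limit_set_approx y by blast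
    define x' where "x' n = (R / max R (norm (x n))) *\<^sub>R x n" for n
    have m: "max R (norm (x n)) > 0" for n using R by linarith
    have x'F: "x' n \<in> F n \<inter> cball 0 R" for n
    proof -
      have "(R / max R (norm (x n))) *\<^sub>R x n + (1 - R / max R (norm (x n))) *\<^sub>R 0 \<in> F n"
        using R m[of n] by (intro convexD[OF convex_F] x zero_F) (auto simp: field_simps)
      moreover have "norm (x' n) \<le> R"
      proof -
        have "R * norm (x n) \<le> R * max R (norm (x n))" using R by (intro mult_left_mono) auto
        then show ?thesis using R m[of n] by (simp add: x'_def pos_divide_le_eq)
      qed
      ultimately show ?thesis by (simp add: x'_def)
    qed
    have "x' \<longlonglongrightarrow> (R / max R (norm y)) *\<^sub>R y"
      unfolding x'_def using R by (intro tendsto_intros x(2)) linarith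
    moreover have "max R (norm y) = R" using y by auto
    ultimately have lx: "x' \<longlonglongrightarrow> y" using R by simp
    have sub: "strict_mono (\<lambda>n. t (k n))" using t(1) k(1) by (auto simp: strict_mono_def)
    have l1: "(\<lambda>n. x' (t (k n))) \<longlonglongrightarrow> y" using LIMSEQ_subseq_LIMSEQ[OF lx sub] by (simp add: o_def)
    have "(\<lambda>n. dist (x' (t (k n))) ((b \<circ> k) n)) \<longlonglongrightarrow> dist y y"
      by (intro tendsto_dist l1 k(2))
    then have "\<forall>\<^sub>F n in sequentially. dist (x' (t (k n))) ((b \<circ> k) n) < e"
      using e by (simp add: order_tendstoD(2))
    moreover have "\<not> dist (x' (t (k n))) ((b \<circ> k) n) \<le> e" for n using b(2)[OF x'F] by simp
    ultimately show False
      by (meson eventually_sequentially less_imp_le order_refl)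
  qed
  from eventually_conj[OF 1 2]
  show "\<forall>\<^sub>F n in sequentially. (\<forall>a\<in>F n \<inter> cball 0 R. \<exists>b\<in>limit_set \<inter> cball 0 R. dist a b \<le> e) \<and>
      (\<forall>b\<in>limit_set \<inter> cball 0 R. \<exists>a\<in>F n \<inter> cball 0 R. dist a b \<le> e)" .
qed

end

lemma properly_convex_domains_compactness:
  fixes U :: "nat \<Rightarrow> (complex ^ 'd) set"
  assumes U: "\<And>n. open (U n)" "\<And>n. convex (U n)"
    and c: "c > 0" "\<And>n. ball 0 c \<subseteq> U n"
    and core: "\<And>n w. disc_in (U n) 0 w \<Longrightarrow> norm w \<le> b"
  obtains r :: "nat \<Rightarrow> nat" and D where "strict_mono r" "D \<in> \<bbbX>"
    "local_hausdorff_tendsto (\<lambda>n. U (r n)) D"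
    "\<And>x y. \<forall>\<^sub>F n in sequentially. x n \<in> closure (U (r n)) \<Longrightarrow> x \<longlonglongrightarrow> y \<Longrightarrow> y \<in> closure D"
    "\<And>x y. y \<in> D \<Longrightarrow> x \<longlonglongrightarrow> y \<Longrightarrow> \<forall>\<^sub>F n in sequentially. x n \<in> U (r n)"
proof -
  have "0 \<in> closure (U n)" for n using c closure_subset[of "U n"] by (meson centre_in_ball subsetD)
  then obtain r :: "nat \<Rightarrow> nat" where r: "strict_mono r"
      and conv: "\<And>x. convergent (\<lambda>n. infdist x (closure (U (r n))))"
    using infdist_convergent_subsequence[of "\<lambda>n. closure (U n)"] by blast
  interpret L: converging_convex_sets "\<lambda>n. closure (U (r n))" c
  proof
    show "ball 0 c \<subseteq> closure (U (r n))" for n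
      using c(2) closure_subset by (rule order_trans)
  qed (use U c conv in \<open>auto intro: convex_closure\<close>)
  define D where "D = interior L.limit_set"
  have clD: "closure D = L.limit_set" by (simp add: D_def L.closure_interior_limit_set)
  have 0: "0 \<in> D" using L.zero_interior_limit_set by (simp add: D_def)
  have ev: "\<forall>\<^sub>F n in sequentially. x n \<in> U (r (s n))"
    if "y \<in> D" "x \<longlonglongrightarrow> y" "strict_mono s" for x y and s :: "nat \<Rightarrow> nat"
    using L.eventually_mem_interior[OF that(3) _ that(2)] that(1) U
    by (simp add: D_def open_convex_interior_closure)
  have "\<not> (\<exists>p v. v \<noteq> 0 \<and> range (\<lambda>z::complex. p + z *s v) \<subseteq> D)"
  proof
    assume "\<exists>p v. v \<noteq> 0 \<and> range (\<lambda>z::complex. p + z *s v) \<subseteq> D"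
    then obtain p v where v: "v \<noteq> 0" and pv: "\<And>z. p + z *s v \<in> D" by blast
    have line: "z *s v \<in> L.limit_set" for z
    proof (rule Lim_in_closed_set[OF L.closed_limit_set])
      show "(\<lambda>n. (1 / real (Suc n)) *\<^sub>R p + z *s v) \<longlonglongrightarrow> z *s v"
      proof -
        have "(\<lambda>n. (1 / real (Suc n)) *\<^sub>R p + z *s v) \<longlonglongrightarrow> 0 *\<^sub>R p + z *s v"
          by (intro tendsto_intros LIMSEQ_Suc lim_1_over_n)
        then show ?thesis by simp
      qed
      have "(1 / m) *\<^sub>R p + z *s v \<in> L.limit_set" if m: "m \<ge> 1" for m :: real
      proof -
        have "p + (of_real m * z) *s v \<in> L.limit_set" "0 \<in> L.limit_set"
          using pv closure_subset[of D] 0 unfolding clD by blast+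
        then have "(1 / m) *\<^sub>R (p + (of_real m * z) *s v) + (1 - 1 / m) *\<^sub>R 0 \<in> L.limit_set"
          using m by (intro convexD[OF L.convex_limit_set]) simp_all
        moreover have "(1 / m) *\<^sub>R (p + (of_real m * z) *s v) = (1 / m) *\<^sub>R p + z *s v"
          using m by (simp add: vec_eq_iff scaleR_conv_of_real[where 'a = complex] field_simps)
        ultimately show ?thesis by (simp only: scaleR_zero_right add_0_right)
      qed
      from this[of "real (Suc n)" for n]
      show "\<forall>\<^sub>F n in sequentially. (1 / real (Suc n)) *\<^sub>R p + z *s v \<in> L.limit_set"
        by (intro always_eventually) simp
    qed simp
    have lineD: "z *s v \<in> D" for z
    proof -
      have "(2 * z) *s v - (1/2) *\<^sub>R ((2 * z) *s v - 0) \<in> interior L.limit_set"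
        using line L.zero_interior_limit_set closure_subset[of L.limit_set]
        by (intro mem_interior_closure_convex_shrink L.convex_limit_set) auto
      moreover have "(2 * z) *s v - (1/2) *\<^sub>R ((2 * z) *s v - 0) = z *s v"
        by (simp add: vec_eq_iff scaleR_conv_of_real[where 'a = complex])
      ultimately show ?thesis by (simp add: D_def)
    qed
    define w where "w = ((\<bar>b\<bar> + 1) / norm v) *\<^sub>R v"
    have nw: "norm w > b" using v by (simp add: w_def)
    have "\<exists>\<zeta>. cmod \<zeta> \<le> 1 \<and> \<zeta> *s w \<notin> U (r n)" for n
    proof (rule ccontr)
      assume "\<not> (\<exists>\<zeta>. cmod \<zeta> \<le> 1 \<and> \<zeta> *s w \<notin> U (r n))"
      then have "disc_in (U (r n)) 0 w" using closure_subset[of "U (r n)"] by (auto simp: disc_in_def)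
      then show False using core nw by (meson not_less)
    qed
    then obtain \<zeta> where \<zeta>: "\<And>n. cmod (\<zeta> n) \<le> 1" "\<And>n. \<zeta> n *s w \<notin> U (r n)" by metis
    have "\<forall>n. \<zeta> n \<in> cball 0 1" using \<zeta>(1) by simp
    then obtain \<zeta>0 k where k: "strict_mono (k :: nat \<Rightarrow> nat)" "(\<zeta> \<circ> k) \<longlonglongrightarrow> \<zeta>0"
      by (rule compact_subsequence[OF compact_cball])
    have "\<zeta>0 *s w \<in> D"
      unfolding w_def of_real_vector_smult[symmetric] vector_smult_assoc by (rule lineD)
    moreover have "(\<lambda>n. \<zeta> (k n) *s w) \<longlonglongrightarrow> \<zeta>0 *s w"
      using k(2) by (intro tendsto_intros) (simp add: o_def)
    ultimately have "\<forall>\<^sub>F n in sequentially. \<zeta> (k n) *s w \<in> U (r (k n))"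
      using ev k(1) by blast
    then show False using \<zeta>(2) by (meson eventually_sequentially order_refl)
  qed
  then have d1: "D \<in> \<bbbX>"
    using 0 L.convex_limit_set
    by (auto simp: properly_convex_domains_def C_properly_convex_def D_def convex_interior)
  have d2: "local_hausdorff_tendsto (\<lambda>n. U (r n)) D"
    unfolding local_hausdorff_tendsto_def
    by (rule exI[of _ 1]) (use L.local_hausdorff_limit_set clD in auto)
  have d3: "y \<in> closure D" if x: "\<forall>\<^sub>F n in sequentially. x n \<in> closure (U (r n))" "x \<longlonglongrightarrow> y" for x y
  proof -
    define x' where "x' n = (if x n \<in> closure (U (r n)) then x n else 0)" for n
    have "\<forall>\<^sub>F n in sequentially. x' n = x n" using x(1) by eventually_elim (simp add: x'_def)
    then have "x' \<longlonglongrightarrow> y" using x(2) by (simp add: tendsto_cong)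
    moreover have "x' n \<in> closure (U (id (r n)))" for n using L.zero_F[of n] by (simp add: x'_def)
    ultimately show ?thesis
      using L.limit_setI[of id x' y] clD by (simp add: strict_mono_def)
  qed
  have d4: "\<forall>\<^sub>F n in sequentially. x n \<in> U (r n)" if "y \<in> D" "x \<longlonglongrightarrow> y" for x y
    using ev[OF that, of id] by (simp add: strict_mono_def)
  show ?thesis by (rule that[OF r d1 d2]) (fact d3, fact d4)
qed

subsection \<open>Size of discs near the boundary\<close>

context
  fixes B M :: "complex ^ 'd ^ 'd"
  assumes BM: "B ** M = mat 1" and MB: "M ** B = mat 1"
begin

lemma inverse_matrix_cancel: "B *v (M *v x) = x" "M *v (B *v x) = x"
  by (simp_all add: matrix_vector_mul_assoc BM MB)

lemma affine_image_eq_vimage: "(\<lambda>z. B *v z + b) ` S = (\<lambda>y. M *v (y - b)) -` S"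
proof (intro set_eqI iffI)
  fix y assume "y \<in> (\<lambda>y. M *v (y - b)) -` S"
  then show "y \<in> (\<lambda>z. B *v z + b) ` S"
    by (intro image_eqI[of _ _ "M *v (y - b)"]) (auto simp: inverse_matrix_cancel)
qed (auto simp: inverse_matrix_cancel)

lemma open_affine_image: "open S \<Longrightarrow> open ((\<lambda>z. B *v z + b) ` S)"
  unfolding affine_image_eq_vimage
  by (intro open_vimage continuous_intros
      linear_continuous_on_compose[of _ "\<lambda>x. x - b" "\<lambda>x. M *v x"]
      bounded_linear.linear[OF matrix_vector_mul_bounded_linear])

lemma convex_affine_image: "convex S \<Longrightarrow> convex ((\<lambda>z. B *v z + b) ` S)"
proof -
  assume "convex S"
  then have "convex ((+) b ` ((*v) B ` S))"
    by (intro convex_translation convex_linear_image bounded_linear.linear[OF matrix_vector_mul_bounded_linear])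
  then show ?thesis by (simp add: image_image add.commute)
qed

lemma closure_affine_image: "closure ((\<lambda>z. B *v z + b) ` S) = (\<lambda>z. B *v z + b) ` closure S"
proof -
  have "inj ((*v) B)" by (rule injI) (metis inverse_matrix_cancel(2))
  then have "(*v) B ` closure S = closure ((*v) B ` S)"
    by (intro closure_injective_linear_image bounded_linear.linear[OF matrix_vector_mul_bounded_linear])
  then have "(+) b ` (*v) B ` closure S = closure ((+) b ` (*v) B ` S)"
    by (simp add: closure_translation)
  then show ?thesis by (simp add: image_image add.commute)
qed

lemma affine_image_mem_iff: "B *v x + b \<in> (\<lambda>z. B *v z + b) ` S \<longleftrightarrow> x \<in> S"
  by (auto simp: affine_image_eq_vimage inverse_matrix_cancel)

lemma disc_in_affine_image:
  "disc_in ((\<lambda>z. B *v z + b) ` \<Omega>) (B *v p + b) (B *v w) \<longleftrightarrow> disc_in \<Omega> p w"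
proof -
  have "B *v p + b + \<zeta> *s (B *v w) = B *v (p + \<zeta> *s w) + b" for \<zeta>
    by (simp add: matrix_vector_right_distrib vector_scalar_commute)
  then show ?thesis
    unfolding disc_in_def closure_affine_image by (simp only: affine_image_mem_iff)
qed

end

lemma ball_infdist_subset: "ball p (infdist p (- \<Omega>)) \<subseteq> \<Omega>"
proof
  fix y assume y: "y \<in> ball p (infdist p (- \<Omega>))"
  show "y \<in> \<Omega>"
  proof (rule ccontr)
    assume "y \<notin> \<Omega>"
    then have "infdist p (- \<Omega>) \<le> dist p y" by (intro infdist_le) auto
    then show False using y by simp
  qed
qed

lemma infdist_ge_of_ball_subset:
  assumes "- \<Omega> \<noteq> {}" "ball p r \<subseteq> \<Omega>"
  shows "r \<le> infdist p (- \<Omega>)"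
proof -
  have "r \<le> dist p a" if "a \<in> - \<Omega>" for a
    using assms(2) that by (meson ComplD mem_ball not_le subsetD)
  then show ?thesis unfolding infdist_def using assms(1) by (auto intro: cINF_greatest)
qed

lemma C_properly_convex_complement_nonempty:
  fixes \<Omega> :: "(complex ^ 'd) set"
  assumes "C_properly_convex \<Omega>"
  shows "- \<Omega> \<noteq> {}"
proof
  assume "- \<Omega> = {}"
  then have "\<Omega> = UNIV" by auto
  then have "range (\<lambda>z::complex. 0 + z *s axis undefined 1) \<subseteq> \<Omega>" by auto
  moreover have "axis undefined (1::complex) \<noteq> (0 :: complex ^ 'd)" by simp
  ultimately show False using assms unfolding C_properly_convex_def by blast
qed

text \<open>If this failed for every choice of constants, a limit of normalised copies of \<open>\<Omega>\<close> would
  contain in its boundary a translate of a complex sector, namely of the limit of the cones spanned by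
  \<open>p\<close> and a ball around \<open>o'\<close>.\<close>

lemma disc_growth:
  fixes \<Omega> :: "(complex ^ 'd) set"
  assumes \<Omega>X: "\<Omega> \<in> \<bbbX>" and simple: "\<forall>D \<in> aff_orbit_closure \<Omega>. simple_boundary D" and o: "o' \<in> \<Omega>"
  shows "\<exists>\<epsilon>>0. \<exists>K\<ge>0. \<exists>r0>0. K * r0 \<le> 1 \<and>
    (\<forall>p\<in>\<Omega> \<inter> cball 0 R. \<forall>w. infdist p (- \<Omega>) \<le> r0 \<longrightarrow> disc_in \<Omega> p w \<longrightarrow>
      disc_in \<Omega> (p + (K * infdist p (- \<Omega>)) *\<^sub>R (o' - p)) ((1 + \<epsilon>) *\<^sub>R w))"
proof (rule ccontr)
  assume neg: "\<not> ?thesis"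
  have CP: "C_properly_convex \<Omega>" and ne: "\<Omega> \<noteq> {}" and op: "open \<Omega>" and cv: "convex \<Omega>"
    using \<Omega>X by (auto simp: properly_convex_domains_def C_properly_convex_def)
  note compl = C_properly_convex_complement_nonempty[OF CP]
  obtain \<rho> where \<rho>: "\<rho> > 0" "ball o' \<rho> \<subseteq> \<Omega>" using op o open_contains_ball by blast
  define L where "L = \<bar>R\<bar> + norm o' + 1"
  have L: "L > 0" unfolding L_def by (simp add: add_nonneg_pos)
  define m where "m n = real n + 1" for n
  have m: "m n \<ge> 1" "m n > 0" for n by (simp_all add: m_def)
  have "\<exists>p w \<zeta>. p \<in> \<Omega> \<and> norm p \<le> R \<and> infdist p (- \<Omega>) \<le> 1 / (m n)\<^sup>2 \<and> disc_in \<Omega> p w \<and>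
      cmod \<zeta> \<le> 1 \<and> p + (m n * infdist p (- \<Omega>)) *\<^sub>R (o' - p) + \<zeta> *s ((1 + 1 / m n) *\<^sub>R w) \<notin> closure \<Omega>" for n
  proof (rule ccontr)
    assume *: "\<not> ?thesis"
    have "1 / m n > 0" "m n \<ge> 0" "1 / (m n)\<^sup>2 > 0" "m n * (1 / (m n)\<^sup>2) \<le> 1"
      using m[of n] by (auto simp: power2_eq_square)
    moreover have "\<forall>p\<in>\<Omega> \<inter> cball 0 R. \<forall>w. infdist p (- \<Omega>) \<le> 1 / (m n)\<^sup>2 \<longrightarrow> disc_in \<Omega> p w \<longrightarrow>
        disc_in \<Omega> (p + (m n * infdist p (- \<Omega>)) *\<^sub>R (o' - p)) ((1 + 1 / m n) *\<^sub>R w)"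
    proof (intro ballI allI impI)
      fix p w assume "p \<in> \<Omega> \<inter> cball 0 R" "infdist p (- \<Omega>) \<le> 1 / (m n)\<^sup>2" "disc_in \<Omega> p w"
      then show "disc_in \<Omega> (p + (m n * infdist p (- \<Omega>)) *\<^sub>R (o' - p)) ((1 + 1 / m n) *\<^sub>R w)"
        unfolding disc_in_def[of \<Omega> "p + _"] using * by auto
    qed
    ultimately show False using neg by blast
  qed
  then obtain P W Z where P: "\<And>n. P n \<in> \<Omega>" "\<And>n. norm (P n) \<le> R"
    and d_le: "\<And>n. infdist (P n) (- \<Omega>) \<le> 1 / (m n)\<^sup>2" and W: "\<And>n. disc_in \<Omega> (P n) (W n)"
    and Z: "\<And>n. cmod (Z n) \<le> 1"
    and out: "\<And>n. P n + (m n * infdist (P n) (- \<Omega>)) *\<^sub>R (o' - P n) + Z n *s ((1 + 1 / m n) *\<^sub>R W n) \<notin> closure \<Omega>"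
    by metis
  define \<delta> where "\<delta> n = infdist (P n) (- \<Omega>)" for n
  have \<delta>: "\<delta> n > 0" for n
  proof -
    obtain e where e: "e > 0" "ball (P n) e \<subseteq> \<Omega>" using op P open_contains_ball by blast
    then show ?thesis using infdist_ge_of_ball_subset[OF compl e(2)] by (simp add: \<delta>_def)
  qed
  have oL: "norm (o' - P n) < L" for n
    using norm_triangle_ineq4[of o' "P n"] P(2)[of n] unfolding L_def by linarith
  let ?d = "real CARD('d)"
  have dpos: "?d > 0" by simp
  have "\<exists>B M :: complex ^ 'd ^ 'd. B ** M = mat 1 \<and> M ** B = mat 1 \<and>
      (\<forall>w. disc_in \<Omega> (P n) w \<longrightarrow> norm (B *v w) \<le> ?d) \<and> (\<forall>u. norm u \<le> 1 / ?d \<longrightarrow> P n + M *v u \<in> closure \<Omega>)" for n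
    by (rule balanced_normalization[OF CP P(1)[of n]]) blast
  then obtain B M :: "nat \<Rightarrow> complex ^ 'd ^ 'd" where BM: "\<And>n. B n ** M n = mat 1" "\<And>n. M n ** B n = mat 1"
    and core: "\<And>n w. disc_in \<Omega> (P n) w \<Longrightarrow> norm (B n *v w) \<le> ?d"
    and inner: "\<And>n u. norm u \<le> 1 / ?d \<Longrightarrow> P n + M n *v u \<in> closure \<Omega>"
    by metis
  define A where "A n z = B n *v z + (- (B n *v P n))" for n z
  have A_diff: "A n z = B n *v (z - P n)" for n z
    by (simp add: A_def matrix_vector_mult_diff_distrib)
  define U where "U n = A n ` \<Omega>" for n
  have Aimg: "A n ` S = (\<lambda>z. B n *v z + (- (B n *v P n))) ` S" for n S by (simp add: A_def)
  have U: "open (U n)" "convex (U n)" for n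
    unfolding U_def Aimg by (intro open_affine_image[OF BM] convex_affine_image[OF BM] op cv)+
  have clU: "closure (U n) = A n ` closure \<Omega>" for n
    unfolding U_def Aimg by (rule closure_affine_image[OF BM])
  have A_mem: "A n x \<in> A n ` S \<longleftrightarrow> x \<in> S" for n x S
    unfolding Aimg unfolding A_def by (rule affine_image_mem_iff[OF BM])
  have ballU: "ball 0 (1 / ?d) \<subseteq> U n" for n
  proof -
    have "u \<in> closure (U n)" if "u \<in> ball 0 (1 / ?d)" for u
    proof -
      have "A n (P n + M n *v u) \<in> closure (U n)"
        unfolding clU A_mem using that by (intro inner) simp
      then show ?thesis by (simp add: A_diff inverse_matrix_cancel[OF BM])
    qed
    then have "ball 0 (1 / ?d) \<subseteq> interior (closure (U n))" by (intro interior_maximal) auto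
    then show ?thesis using U by (simp add: open_convex_interior_closure)
  qed
  have coreU: "norm w \<le> ?d" if "disc_in (U n) 0 w" for n w
  proof -
    have "A n (P n) = 0" by (simp add: A_diff)
    then have "disc_in (A n ` \<Omega>) (A n (P n)) (B n *v (M n *v w))"
      using that by (simp add: U_def inverse_matrix_cancel[OF BM])
    then have "disc_in \<Omega> (P n) (M n *v w)"
      unfolding Aimg unfolding A_def by (simp only: disc_in_affine_image[OF BM])
    from core[OF this] show ?thesis by (simp add: inverse_matrix_cancel[OF BM])
  qed
  define a where "a n = \<delta> n *\<^sub>R (B n *v (o' - P n))" for n
  define v where "v n = B n *v W n" for n
  define \<zeta> where "\<zeta> n = of_real (1 + 1 / m n) * Z n" for n
  have B_scaleR: "B n *v (x *\<^sub>R y) = x *\<^sub>R (B n *v y)" for n x y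
    by (simp only: of_real_vector_smult[symmetric] vector_scalar_commute)
  have A_line: "A n (P n + z *s (o' - P n)) = (z / of_real (\<delta> n)) *s a n" for n z
  proof -
    have "(z / of_real (\<delta> n)) * of_real (\<delta> n) = z" using \<delta>[of n] by simp
    then show ?thesis
      by (simp only: A_diff add_diff_cancel_left' a_def vector_scalar_commute
          of_real_vector_smult[symmetric] vector_smult_assoc)
  qed
  have a_bd: "norm (a n) \<le> L * ?d" for n
  proof -
    have "disc_in \<Omega> (P n) ((\<delta> n / L) *\<^sub>R (o' - P n))"
      unfolding disc_in_def
    proof (intro allI impI)
      fix z assume z: "cmod z \<le> 1"
      have "norm (z *s ((\<delta> n / L) *\<^sub>R (o' - P n))) = cmod z * (\<delta> n * (norm (o' - P n) / L))"
        using \<delta>[of n] L by (simp add: norm_vector_smult)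
      also have "\<dots> \<le> 1 * (\<delta> n * (norm (o' - P n) / L))"
        using z \<delta>[of n] L by (intro mult_right_mono) auto
      also have "\<dots> < 1 * (\<delta> n * 1)"
        using \<delta>[of n] L oL[of n] by (intro mult_strict_left_mono) auto
      also have "\<dots> = \<delta> n" by simp
      finally have "P n + z *s ((\<delta> n / L) *\<^sub>R (o' - P n)) \<in> ball (P n) (\<delta> n)"
        by (simp add: dist_norm)
      then show "P n + z *s ((\<delta> n / L) *\<^sub>R (o' - P n)) \<in> closure \<Omega>"
        using ball_infdist_subset closure_subset unfolding \<delta>_def by blast
    qed
    from core[OF this] have "norm ((\<delta> n / L) *\<^sub>R (B n *v (o' - P n))) \<le> ?d" by (simp only: B_scaleR)
    also have "(\<delta> n / L) *\<^sub>R (B n *v (o' - P n)) = (1 / L) *\<^sub>R a n" by (simp add: a_def)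
    finally show ?thesis using L by (simp add: field_simps)
  qed
  have v_bd: "norm (v n) \<le> ?d" for n unfolding v_def by (rule core[OF W])
  have \<zeta>_bd: "cmod (\<zeta> n) \<le> 2" for n
  proof -
    have "cmod (\<zeta> n) \<le> (1 + 1 / m n) * 1"
      unfolding \<zeta>_def norm_mult using Z m[of n] by (intro mult_mono) (auto simp: norm_of_real simp del: of_real_add)
    also have "\<dots> \<le> 2" using m[of n] by simp
    finally show ?thesis .
  qed
  have "compact (cball (0::complex^'d) (L * ?d) \<times> cball (0::complex^'d) ?d \<times> cball (0::complex) 2)"
    by (intro compact_Times compact_cball)
  moreover have "\<forall>n. (a n, v n, \<zeta> n) \<in> cball 0 (L * ?d) \<times> cball 0 ?d \<times> cball 0 2"
    using a_bd v_bd \<zeta>_bd by simp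
  ultimately obtain l k where k: "strict_mono (k :: nat \<Rightarrow> nat)" and l: "((\<lambda>n. (a n, v n, \<zeta> n)) \<circ> k) \<longlonglongrightarrow> l"
    by (rule compact_subsequence)
  obtain a0 v0 \<zeta>0 where leq: "l = (a0, v0, \<zeta>0)" by (cases l)
  have lk: "(\<lambda>n. a (k n)) \<longlonglongrightarrow> a0" "(\<lambda>n. v (k n)) \<longlonglongrightarrow> v0" "(\<lambda>n. \<zeta> (k n)) \<longlonglongrightarrow> \<zeta>0"
    using tendsto_fst[OF l] tendsto_fst[OF tendsto_snd[OF l]] tendsto_snd[OF tendsto_snd[OF l]]
    by (simp_all add: leq o_def)
  obtain r D where r: "strict_mono r" and DX: "D \<in> \<bbbX>" and conv: "local_hausdorff_tendsto (\<lambda>n. U (k (r n))) D"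
    and lim_mem: "\<And>x y. \<forall>\<^sub>F n in sequentially. x n \<in> closure (U (k (r n))) \<Longrightarrow> x \<longlonglongrightarrow> y \<Longrightarrow> y \<in> closure D"
    and int_mem: "\<And>x y. y \<in> D \<Longrightarrow> x \<longlonglongrightarrow> y \<Longrightarrow> \<forall>\<^sub>F n in sequentially. x n \<in> U (k (r n))"
  proof (rule properly_convex_domains_compactness[of "\<lambda>n. U (k n)" "1 / ?d" ?d])
  qed (use U ballU coreU dpos in \<open>simp_all\<close>)
  define s where "s n = k (r n)" for n
  have s: "strict_mono s" using k r by (auto simp: s_def strict_mono_def)
  have ls: "(\<lambda>n. a (s n)) \<longlonglongrightarrow> a0" "(\<lambda>n. v (s n)) \<longlonglongrightarrow> v0" "(\<lambda>n. \<zeta> (s n)) \<longlonglongrightarrow> \<zeta>0"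
    using lk[THEN LIMSEQ_subseq_LIMSEQ, OF r] by (simp_all add: o_def s_def)
  have lim_m0: "(\<lambda>n. 1 / m n) \<longlonglongrightarrow> 0"
    unfolding m_def using LIMSEQ_inverse_real_of_nat by (simp add: inverse_eq_divide add.commute)
  have lim_m: "(\<lambda>n. 1 / m (s n)) \<longlonglongrightarrow> 0" using LIMSEQ_subseq_LIMSEQ[OF lim_m0 s] by (simp add: o_def)
  have \<delta>_le: "\<delta> n \<le> 1 / m n * (1 / m n)" for n using d_le[of n] by (simp add: \<delta>_def power2_eq_square)
  have m\<delta>_le: "m n * \<delta> n \<le> 1 / m n" for n
  proof -
    have "m n * \<delta> n \<le> m n * (1 / m n * (1 / m n))" using \<delta>_le m[of n] by (intro mult_left_mono) auto
    then show ?thesis using m[of n] by simp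
  qed
  have lim_m\<delta>: "(\<lambda>n. m (s n) * \<delta> (s n)) \<longlonglongrightarrow> 0"
  proof (rule tendsto_sandwich[OF _ _ tendsto_const lim_m])
    show "\<forall>\<^sub>F n in sequentially. 0 \<le> m (s n) * \<delta> (s n)"
      using m \<delta> by (intro always_eventually) (auto intro!: mult_nonneg_nonneg less_imp_le)
  qed (use m\<delta>_le in auto)
  have lim_\<delta>: "(\<lambda>n. \<delta> (s n)) \<longlonglongrightarrow> 0"
  proof (rule tendsto_sandwich[OF _ _ tendsto_const lim_m\<delta>])
    show "\<forall>\<^sub>F n in sequentially. 0 \<le> \<delta> (s n)"
      by (intro always_eventually allI less_imp_le \<delta>)
    show "\<forall>\<^sub>F n in sequentially. \<delta> (s n) \<le> m (s n) * \<delta> (s n)"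
      using m \<delta> by (intro always_eventually) (auto simp: less_imp_le)
  qed
  have D: "open D" "convex D" using DX by (auto simp: properly_convex_domains_def C_properly_convex_def)
  have "D \<in> aff_orbit_closure \<Omega>"
    unfolding aff_orbit_closure_def
  proof (intro CollectI conjI DX exI[of _ "\<lambda>n. A (s n)"] allI)
    show "A (s n) \<in> Aff" for n
    proof -
      have "invertible (B (s n))" using BM[of "s n"] unfolding invertible_def by blast
      then show ?thesis unfolding Aff_def A_def[abs_def] by blast
    qed
    show "local_hausdorff_tendsto (\<lambda>n. A (s n) ` \<Omega>) D" using conv by (simp add: U_def s_def)
  qed
  then have simpleD: "simple_boundary D" using simple by blast

  have a0: "a0 \<noteq> 0"
  proof
    assume "a0 = 0"
    have "(\<lambda>n. (- (3 / \<rho>)) *\<^sub>R a (s n)) \<longlonglongrightarrow> (- (3 / \<rho>)) *\<^sub>R a0" by (intro tendsto_intros ls)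
    then have "\<forall>\<^sub>F n in sequentially. (- (3 / \<rho>)) *\<^sub>R a (s n) \<in> ball 0 (1 / ?d)"
      using dpos unfolding \<open>a0 = 0\<close> by (intro topological_tendstoD) auto
    moreover have "(\<lambda>n. 3 / \<rho> * \<delta> (s n)) \<longlonglongrightarrow> 3 / \<rho> * 0" by (intro tendsto_intros lim_\<delta>)
    then have "\<forall>\<^sub>F n in sequentially. 3 / \<rho> * \<delta> (s n) < 1" by (intro order_tendstoD(2)) auto
    ultimately have "\<forall>\<^sub>F n in sequentially. False"
    proof eventually_elim
      case (elim n)
      let ?n = "s n"
      define t where "t = 3 / \<rho> * \<delta> ?n"
      have t: "0 < t" "t < 1" using \<delta>[of ?n] \<rho> elim by (auto simp: t_def)
      define x where "x = P ?n + of_real (- t) *s (o' - P ?n)"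
      have "A ?n x = (- (3 / \<rho>)) *\<^sub>R a ?n"
        unfolding x_def A_line unfolding of_real_vector_smult[symmetric]
        using \<delta>[of ?n] by (simp add: t_def)
      also have "\<dots> \<in> U ?n" using elim ballU by blast
      finally have x: "x \<in> \<Omega>" unfolding U_def A_mem .
      define q where "q = t / (1 + t)"
      have q: "0 \<le> q" "q \<le> 1" using t by (auto simp: q_def)
      have "ball (x + q *\<^sub>R (o' - x)) (q * \<rho>) \<subseteq> \<Omega>"
        by (rule ball_convex_combination_subset[OF cv x \<rho>(2) q])
      moreover have "x + q *\<^sub>R (o' - x) = P ?n"
      proof -
        have "x + q *\<^sub>R (o' - x) = P ?n + (q * (1 + t) - t) *\<^sub>R (o' - P ?n)"
          unfolding x_def of_real_vector_smult by (simp add: algebra_simps)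
        also have "q * (1 + t) - t = 0" using t by (simp add: q_def)
        finally show ?thesis by simp
      qed
      ultimately have "q * \<rho> \<le> \<delta> ?n"
        unfolding \<delta>_def by (intro infdist_ge_of_ball_subset compl) simp
      then have "q * \<rho> * 3 \<le> t * \<rho>" using \<rho> by (simp add: t_def)
      then have "q * 3 \<le> t" using \<rho> by (simp add: mult.commute mult.left_commute)
      then have "t * 3 \<le> t * (1 + t)" using t by (simp add: q_def pos_divide_le_eq)
      then show False using t by simp
    qed
    then show False by simp
  qed

  define \<kappa> where "\<kappa> = \<rho> / (2 * L)"
  have \<kappa>: "\<kappa> > 0" using \<rho> L by (simp add: \<kappa>_def)
  have sector: "(of_real \<tau> * (1 + \<eta>)) *s a0 \<in> closure D" if \<tau>: "\<tau> \<ge> 0" and \<eta>: "cmod \<eta> \<le> \<kappa>" for \<tau> \<eta>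
  proof (rule lim_mem)
    show "(\<lambda>n. (of_real \<tau> * (1 + \<eta>)) *s a (s n)) \<longlonglongrightarrow> (of_real \<tau> * (1 + \<eta>)) *s a0"
      by (intro tendsto_intros ls)
    have "(\<lambda>n. \<tau> * \<delta> (s n)) \<longlonglongrightarrow> \<tau> * 0" by (intro tendsto_intros lim_\<delta>)
    then have "\<forall>\<^sub>F n in sequentially. \<tau> * \<delta> (s n) < 1" by (intro order_tendstoD(2)) auto
    then show "\<forall>\<^sub>F n in sequentially. (of_real \<tau> * (1 + \<eta>)) *s a (s n) \<in> closure (U (k (r n)))"
    proof eventually_elim
      case (elim n)
      let ?n = "s n" and ?t = "\<tau> * \<delta> (s n)"
      have t: "0 \<le> ?t" "?t \<le> 1" using \<tau> \<delta>[of ?n] elim by auto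
      define y where "y = o' + \<eta> *s (o' - P ?n)"
      have "norm (\<eta> *s (o' - P ?n)) \<le> \<kappa> * L"
        unfolding norm_vector_smult using \<eta> oL[of ?n] \<kappa> by (intro mult_mono) auto
      also have "\<dots> < \<rho>" using \<rho> L by (simp add: \<kappa>_def)
      finally have "dist (o' + \<eta> *s (o' - P ?n)) o' < \<rho>" by (simp only: dist_norm add_diff_cancel_left')
      then have "y \<in> \<Omega>" using \<rho>(2) unfolding y_def by (meson dist_commute_lessI mem_ball subsetD)
      then have "(1 - ?t) *\<^sub>R P ?n + ?t *\<^sub>R y \<in> \<Omega>" by (intro convexD_alt[OF cv P(1)] t)
      moreover have "(1 - ?t) *\<^sub>R P ?n + ?t *\<^sub>R y = P ?n + (of_real ?t * (1 + \<eta>)) *s (o' - P ?n)"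
        by (simp add: y_def vec_eq_iff scaleR_conv_of_real[where 'a = complex] algebra_simps)
      ultimately have "A ?n (P ?n + (of_real ?t * (1 + \<eta>)) *s (o' - P ?n)) \<in> U ?n"
        unfolding U_def by simp
      moreover have "of_real ?t * (1 + \<eta>) / of_real (\<delta> ?n) = of_real \<tau> * (1 + \<eta>)"
        using \<delta>[of ?n] by simp
      ultimately have "(of_real \<tau> * (1 + \<eta>)) *s a ?n \<in> U ?n" by (simp only: A_line)
      then show ?case using closure_subset by (auto simp: s_def)
    qed
  qed
  define Y where "Y = \<zeta>0 *s v0"
  have Y: "Y \<in> closure D"
  proof (rule lim_mem)
    have "(\<lambda>n. of_real (1 / (1 + 1 / m (s n))) * \<zeta> (s n)) \<longlonglongrightarrow> of_real (1 / (1 + 0)) * \<zeta>0"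
      by (intro tendsto_intros ls lim_m) auto
    moreover have "of_real (1 / (1 + 1 / m n)) * \<zeta> n = Z n" for n
    proof -
      have "1 + 1 / m n \<noteq> 0" using m[of n] by (metis add_pos_pos divide_pos_pos less_irrefl zero_less_one)
      then have "complex_of_real (1 / (1 + 1 / m n)) * of_real (1 + 1 / m n) = 1"
        by (simp only: of_real_mult[symmetric]) simp
      then show ?thesis unfolding \<zeta>_def mult.assoc[symmetric] by simp
    qed
    ultimately have "(\<lambda>n. Z (s n)) \<longlonglongrightarrow> \<zeta>0" by simp
    then show "(\<lambda>n. Z (s n) *s v (s n)) \<longlonglongrightarrow> Y" unfolding Y_def by (intro tendsto_intros ls)
    have "Z (s n) *s v (s n) \<in> closure (U (s n))" for n
    proof -
      have "P (s n) + Z (s n) *s W (s n) \<in> closure \<Omega>" using W[of "s n"] Z[of "s n"] by (simp add: disc_in_def)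
      then have "A (s n) (P (s n) + Z (s n) *s W (s n)) \<in> closure (U (s n))" unfolding clU by blast
      then show ?thesis by (simp add: A_diff v_def vector_scalar_commute)
    qed
    then show "\<forall>\<^sub>F n in sequentially. Z (s n) *s v (s n) \<in> closure (U (k (r n)))"
      by (simp add: s_def)
  qed
  define \<phi> where "\<phi> z = Y + (1 + of_real \<kappa> * z) *s a0" for z
  have \<phi>_cl: "\<phi> z \<in> closure D" if z: "z \<in> ball 0 1" for z
  proof (rule Lim_in_closed_set[OF closed_closure])
    define w where "w = (1 + of_real \<kappa> * z) *s a0"
    show "(\<lambda>n. (1 - 1 / m n) *\<^sub>R Y + w) \<longlonglongrightarrow> \<phi> z"
    proof -
      have "(\<lambda>n. (1 - 1 / m n) *\<^sub>R Y + w) \<longlonglongrightarrow> (1 - 0) *\<^sub>R Y + w" by (intro tendsto_intros lim_m0)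
      then show ?thesis by (simp add: \<phi>_def w_def)
    qed
    have "(1 - 1 / m n) *\<^sub>R Y + w \<in> closure D" for n
    proof -
      have "cmod (of_real \<kappa> * z) \<le> \<kappa>" using z \<kappa> by (simp add: norm_mult mult_left_le)
      then have "(of_real (m n) * (1 + of_real \<kappa> * z)) *s a0 \<in> closure D" using m[of n] by (intro sector) auto
      then have "(1 - 1 / m n) *\<^sub>R Y + (1 / m n) *\<^sub>R ((of_real (m n) * (1 + of_real \<kappa> * z)) *s a0) \<in> closure D"
        using m[of n] by (intro convexD[OF convex_closure[OF D(2)] Y]) auto
      moreover have "(1 / m n) *\<^sub>R ((of_real (m n) * (1 + of_real \<kappa> * z)) *s a0) = w"
        using m[of n] by (simp add: w_def vec_eq_iff scaleR_conv_of_real[where 'a = complex] algebra_simps)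
      ultimately show ?thesis by simp
    qed
    then show "\<forall>\<^sub>F n in sequentially. (1 - 1 / m n) *\<^sub>R Y + w \<in> closure D" by simp
  qed simp
  have Ya: "Y + a0 \<notin> D"
  proof
    assume YaD: "Y + a0 \<in> D"
    define \<theta> where "\<theta> n = (m n - 1) * \<delta> n" for n
    have \<theta>: "0 \<le> \<theta> n" "\<theta> n < 1" for n
    proof -
      show "0 \<le> \<theta> n" using m[of n] \<delta>[of n] by (simp add: \<theta>_def)
      have "\<theta> n = m n * \<delta> n - \<delta> n" by (simp add: \<theta>_def algebra_simps)
      moreover have "1 / m n \<le> 1" using m[of n] by simp
      ultimately show "\<theta> n < 1" using m\<delta>_le[of n] \<delta>[of n] by linarith
    qed
    have "(\<lambda>n. m (s n) * \<delta> (s n) - \<delta> (s n)) \<longlonglongrightarrow> 0 - 0" by (intro tendsto_intros lim_m\<delta> lim_\<delta>)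
    then have lim\<theta>: "(\<lambda>n. \<theta> (s n)) \<longlonglongrightarrow> 0" by (simp add: \<theta>_def algebra_simps)
    define X where "X n = (1 / (1 - \<theta> n)) *\<^sub>R (\<zeta> n *s v n + a n)" for n
    have "(\<lambda>n. X (s n)) \<longlonglongrightarrow> (1 / (1 - 0)) *\<^sub>R (\<zeta>0 *s v0 + a0)"
      unfolding X_def by (intro tendsto_intros ls lim\<theta>) simp
    then have "(\<lambda>n. X (s n)) \<longlonglongrightarrow> Y + a0" by (simp add: Y_def)
    from int_mem[OF YaD this] have "\<forall>\<^sub>F n in sequentially. X (s n) \<in> U (s n)" by (simp add: s_def)
    then obtain n0 where n0: "X (s n0) \<in> U (s n0)" by (meson eventually_sequentially order_refl)
    define n where "n = s n0"
    have Xn: "X n \<in> U n" using n0 by (simp add: n_def)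
    have "A n o' \<in> U n" using o by (simp add: U_def)
    moreover have "A n o' = (1 / \<delta> n) *\<^sub>R a n" using \<delta>[of n] by (simp add: A_diff a_def)
    ultimately have "(1 - \<theta> n) *\<^sub>R X n + \<theta> n *\<^sub>R ((1 / \<delta> n) *\<^sub>R a n) \<in> U n"
      using \<theta>[of n] by (intro convexD_alt[OF U(2) Xn]) auto
    moreover have "(1 - \<theta> n) *\<^sub>R X n = \<zeta> n *s v n + a n" using \<theta>[of n] by (simp add: X_def)
    moreover have "\<theta> n *\<^sub>R ((1 / \<delta> n) *\<^sub>R a n) = (m n - 1) *\<^sub>R a n" using \<delta>[of n] by (simp add: \<theta>_def)
    ultimately have "(\<zeta> n *s v n + a n) + (m n - 1) *\<^sub>R a n \<in> U n" by (simp only:)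
    moreover have "(\<zeta> n *s v n + a n) + (m n - 1) *\<^sub>R a n = \<zeta> n *s v n + m n *\<^sub>R a n"
      by (simp add: algebra_simps)
    moreover have "A n (P n + (m n * \<delta> n) *\<^sub>R (o' - P n) + Z n *s ((1 + 1 / m n) *\<^sub>R W n)) = \<zeta> n *s v n + m n *\<^sub>R a n"
    proof -
      have "Z n *s ((1 + 1 / m n) *\<^sub>R W n) = \<zeta> n *s W n"
        by (simp only: of_real_vector_smult[symmetric] vector_smult_assoc \<zeta>_def mult.commute)
      then have "A n (P n + (m n * \<delta> n) *\<^sub>R (o' - P n) + Z n *s ((1 + 1 / m n) *\<^sub>R W n)) =
          B n *v ((m n * \<delta> n) *\<^sub>R (o' - P n) + \<zeta> n *s W n)"
        by (simp add: A_diff)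
      also have "\<dots> = m n *\<^sub>R a n + \<zeta> n *s v n"
        by (simp add: matrix_vector_right_distrib B_scaleR vector_scalar_commute a_def v_def)
      finally show ?thesis by (simp add: add.commute)
    qed
    ultimately have "A n (P n + (m n * \<delta> n) *\<^sub>R (o' - P n) + Z n *s ((1 + 1 / m n) *\<^sub>R W n)) \<in> closure (U n)"
      using closure_subset by auto
    then show False using out[of n] unfolding clU A_mem \<delta>_def by blast
  qed
  have \<phi>_out: "\<phi> z \<notin> D" if z: "z \<in> ball 0 1" for z
  proof
    assume "\<phi> z \<in> D"
    then have "\<phi> (- z) - (1/2) *\<^sub>R (\<phi> (- z) - \<phi> z) \<in> interior D"
      using \<phi>_cl[of "- z"] z D by (intro mem_interior_closure_convex_shrink) (auto simp: interior_open)
    moreover have "\<phi> (- z) - (1/2) *\<^sub>R (\<phi> (- z) - \<phi> z) = Y + a0"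
      by (simp add: \<phi>_def vec_eq_iff scaleR_conv_of_real[where 'a = complex] field_simps)
    ultimately show False using Ya D by (simp add: interior_open)
  qed
  have "holomorphic_map_on \<phi> (ball 0 1)"
    unfolding holomorphic_map_on_def \<phi>_def by (auto intro!: holomorphic_intros)
  moreover have "\<phi> ` ball 0 1 \<subseteq> frontier D"
    using \<phi>_cl \<phi>_out D by (auto simp: frontier_def interior_open)
  ultimately have "\<phi> constant_on ball 0 1" using simpleD unfolding simple_boundary_def by blast
  moreover have "(0 :: complex) \<in> ball 0 1" "(1/2 :: complex) \<in> ball 0 1" by (simp_all add: norm_divide)
  ultimately have "\<phi> (1/2) = \<phi> 0" unfolding constant_on_def by metis
  then have "(of_real \<kappa> / 2) *s a0 = 0" by (simp add: \<phi>_def vec_eq_iff algebra_simps)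
  then have "cmod (of_real \<kappa> / 2) * norm a0 = 0" by (metis norm_vector_smult norm_zero)
  then show False using a0 \<kappa> by simp
qed

lemma disc_size_decay:
  fixes \<Omega> :: "(complex ^ 'd) set"
  assumes \<Omega>X: "\<Omega> \<in> \<bbbX>" and simple: "\<forall>D \<in> aff_orbit_closure \<Omega>. simple_boundary D"
  shows "\<exists>C>0. \<exists>\<theta>. 0 < \<theta> \<and> \<theta> < 1 \<and> (\<exists>K\<ge>1. \<exists>r0>0. \<forall>k. \<forall>p\<in>\<Omega> \<inter> cball 0 R. \<forall>w.
    infdist p (- \<Omega>) * K ^ k \<le> r0 \<longrightarrow> disc_in \<Omega> p w \<longrightarrow> norm w \<le> C * \<theta> ^ k)"
proof -
  have CP: "C_properly_convex \<Omega>" and ne: "\<Omega> \<noteq> {}" and op: "open \<Omega>" and cv: "convex \<Omega>"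
    using \<Omega>X by (auto simp: properly_convex_domains_def C_properly_convex_def)
  obtain o' where o: "o' \<in> \<Omega>" using ne by blast
  define R' where "R' = max R (norm o')"
  have R': "R' \<ge> 0" "R \<le> R'" "norm o' \<le> R'" by (auto simp: R'_def le_max_iff_disj)
  obtain \<epsilon> K r0 where \<epsilon>: "\<epsilon> > 0" and K: "K \<ge> 0" and r0: "r0 > 0" "K * r0 \<le> 1"
    and growth: "\<And>p w. p \<in> \<Omega> \<inter> cball 0 R' \<Longrightarrow> infdist p (- \<Omega>) \<le> r0 \<Longrightarrow> disc_in \<Omega> p w \<Longrightarrow>
      disc_in \<Omega> (p + (K * infdist p (- \<Omega>)) *\<^sub>R (o' - p)) ((1 + \<epsilon>) *\<^sub>R w)"
    using disc_growth[OF assms o, of R'] by blast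
  obtain C where C: "C > 0" "\<And>p w. p \<in> closure \<Omega> \<inter> cball 0 R' \<Longrightarrow> disc_in \<Omega> p w \<Longrightarrow> norm w \<le> C"
    using disc_in_bounded[OF CP ne, of R'] by blast
  define \<theta> where "\<theta> = 1 / (1 + \<epsilon>)"
  define K' where "K' = 1 + K * (2 * R')"
  have K': "K' \<ge> 1" using K R' by (simp add: K'_def)
  have main: "norm w \<le> C * \<theta> ^ k"
    if "p \<in> \<Omega> \<inter> cball 0 R'" "infdist p (- \<Omega>) * K' ^ k \<le> r0" "disc_in \<Omega> p w" for k p w
    using that
  proof (induction k arbitrary: p w)
    case 0
    then show ?case using C(2)[of p w] closure_subset[of \<Omega>] by auto
  next
    case (Suc k)
    let ?\<delta> = "infdist p (- \<Omega>)"
    define p' where "p' = p + (K * ?\<delta>) *\<^sub>R (o' - p)"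
    have "1 \<le> K' ^ Suc k" using K' by (rule one_le_power)
    then have "?\<delta> * 1 \<le> ?\<delta> * K' ^ Suc k" by (intro mult_left_mono infdist_nonneg)
    then have \<delta>: "?\<delta> \<le> r0" using Suc.prems by simp
    have t: "0 \<le> K * ?\<delta>" "K * ?\<delta> \<le> 1"
      using K mult_left_mono[OF \<delta> K] r0 by (auto simp: infdist_nonneg)
    have "convex (\<Omega> \<inter> cball 0 R')" using cv by (intro convex_Int) auto
    then have "(1 - K * ?\<delta>) *\<^sub>R p + (K * ?\<delta>) *\<^sub>R o' \<in> \<Omega> \<inter> cball 0 R'"
      using Suc.prems(1) o R' t by (intro convexD_alt) auto
    then have p': "p' \<in> \<Omega> \<inter> cball 0 R'" by (simp add: p'_def algebra_simps)
    have "dist p' p \<le> (K * ?\<delta>) * (2 * R')"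
    proof -
      have "norm (o' - p) \<le> 2 * R'" using norm_triangle_ineq4[of o' p] R' Suc.prems(1) by auto
      then have "(K * ?\<delta>) * norm (o' - p) \<le> (K * ?\<delta>) * (2 * R')" using t by (intro mult_left_mono)
      then show ?thesis using t by (simp add: p'_def dist_norm)
    qed
    then have "infdist p' (- \<Omega>) \<le> ?\<delta> * K'"
      using infdist_triangle[of p' "- \<Omega>" p] by (simp add: K'_def algebra_simps)
    then have "infdist p' (- \<Omega>) * K' ^ k \<le> ?\<delta> * K' * K' ^ k"
      using K' by (intro mult_right_mono) auto
    then have "infdist p' (- \<Omega>) * K' ^ k \<le> r0" using Suc.prems(2) by (simp add: mult.assoc)
    moreover have "disc_in \<Omega> p' ((1 + \<epsilon>) *\<^sub>R w)"
      unfolding p'_def by (rule growth[OF Suc.prems(1) \<delta> Suc.prems(3)])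
    ultimately have "norm ((1 + \<epsilon>) *\<^sub>R w) \<le> C * \<theta> ^ k" using Suc.IH p' by blast
    then have "(1 + \<epsilon>) * norm w \<le> C * \<theta> ^ k" using \<epsilon> by simp
    then have "norm w \<le> C * \<theta> ^ k / (1 + \<epsilon>)" using \<epsilon> by (simp add: pos_le_divide_eq mult.commute)
    then show ?case by (simp add: \<theta>_def)
  qed
  have \<theta>: "0 < \<theta>" "\<theta> < 1" using \<epsilon> by (auto simp: \<theta>_def)
  have "\<forall>k. \<forall>p\<in>\<Omega> \<inter> cball 0 R. \<forall>w. infdist p (- \<Omega>) * K' ^ k \<le> r0 \<longrightarrow> disc_in \<Omega> p w \<longrightarrow> norm w \<le> C * \<theta> ^ k"
  proof (intro allI ballI impI)
    fix k p w assume "p \<in> \<Omega> \<inter> cball 0 R" "infdist p (- \<Omega>) * K' ^ k \<le> r0" "disc_in \<Omega> p w"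
    then show "norm w \<le> C * \<theta> ^ k" using R'(2) by (intro main) auto
  qed
  then show ?thesis using C(1) \<theta> K' r0(1) by blast
qed

subsection \<open>Convergence in the end compactification\<close>

lemma limitin_topology_generated_by:
  assumes l: "l \<in> \<Union>S" and ev: "\<And>U. U \<in> S \<Longrightarrow> l \<in> U \<Longrightarrow> \<forall>\<^sub>F x in F. f x \<in> U"
  shows "limitin (topology_generated_by S) f l F"
  unfolding limitin_def
proof (intro conjI allI impI)
  show "l \<in> topspace (topology_generated_by S)" using l by (simp only: topology_generated_by_topspace)
  fix U assume U: "openin (topology_generated_by S) U \<and> l \<in> U"
  then have "generate_topology_on S U" using openin_topology_generated_by by blast
  then have "l \<in> U \<longrightarrow> (\<forall>\<^sub>F x in F. f x \<in> U)"
  proof (induction rule: generate_topology_on.induct)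
    case (Int a b)
    then show ?case by (auto intro: eventually_conj)
  next
    case (UN \<U>)
    show ?case
    proof
      assume "l \<in> \<Union>\<U>"
      then obtain V where "V \<in> \<U>" "l \<in> V" by blast
      then have "\<forall>\<^sub>F x in F. f x \<in> V" using UN by blast
      then show "\<forall>\<^sub>F x in F. f x \<in> \<Union>\<U>" by eventually_elim (use \<open>V \<in> \<U>\<close> in blast)
    qed
  qed (use ev in auto)
  then show "\<forall>\<^sub>F x in F. f x \<in> U" using U by blast
qed

lemma limitin_end_compactificationI:
  assumes l: "l \<in> topspace (end_compactification X)"
    and basic: "\<And>U. openin X U \<Longrightarrow> l \<in> Inl ` U \<Longrightarrow> \<forall>\<^sub>F t in F. f t \<in> U"
    and ends: "\<And>K C. compactin X K \<Longrightarrow> C \<in> connected_components_of (subtopology X (topspace X - K)) \<Longrightarrow>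
      l \<in> Inl ` C \<union> Inr ` {E \<in> ends_of X. E K = C} \<Longrightarrow> \<forall>\<^sub>F t in F. f t \<in> C"
  shows "limitin (end_compactification X) (\<lambda>t. Inl (f t)) l F"
  unfolding end_compactification_def
proof (rule limitin_topology_generated_by)
  let ?S = "{Inl ` U |U. openin X U} \<union>
      {Inl ` C \<union> Inr ` {E \<in> ends_of X. E K = C} |K C. compactin X K \<and>
         C \<in> connected_components_of (subtopology X (topspace X - K))}"
  show "l \<in> \<Union>?S"
    using l unfolding end_compactification_def by (simp only: topology_generated_by_topspace)
  fix V assume V: "V \<in> ?S" "l \<in> V"
  from V(1) show "\<forall>\<^sub>F t in F. Inl (f t) \<in> V"
  proof
    assume "V \<in> {Inl ` U |U. openin X U}"
    then obtain U where U: "V = Inl ` U" "openin X U" by blast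
    have "\<forall>\<^sub>F t in F. f t \<in> U" using basic[OF U(2)] V(2) U(1) by blast
    then show ?thesis by eventually_elim (use U(1) in blast)
  next
    assume "V \<in> {Inl ` C \<union> Inr ` {E \<in> ends_of X. E K = C} |K C. compactin X K \<and>
         C \<in> connected_components_of (subtopology X (topspace X - K))}"
    then obtain K C where KC: "V = Inl ` C \<union> Inr ` {E \<in> ends_of X. E K = C}" "compactin X K"
      "C \<in> connected_components_of (subtopology X (topspace X - K))" by blast
    have "\<forall>\<^sub>F t in F. f t \<in> C" using ends[OF KC(2,3)] V(2) KC(1) by blast
    then show ?thesis by eventually_elim (use KC(1) in blast)
  qed
qed

lemma limitin_end_compactification_Inl:
  fixes S :: "'a::real_normed_vector set"
  assumes S: "convex S" "x \<in> S" and lim: "(f \<longlongrightarrow> x) F" and fS: "\<forall>\<^sub>F t in F. f t \<in> S"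
  shows "limitin (end_compactification (top_of_set S)) (\<lambda>t. Inl (f t)) (Inl x) F"
proof (rule limitin_end_compactificationI)
  show "Inl x \<in> topspace (end_compactification (top_of_set S))"
    using S(2) by (simp add: topspace_end_compactification)
  fix U assume U: "openin (top_of_set S) U" "Inl x \<in> Inl ` U"
  then obtain T where T: "open T" "U = S \<inter> T" by (auto simp: openin_open)
  have "\<forall>\<^sub>F t in F. f t \<in> T" using U T by (intro topological_tendstoD[OF lim]) auto
  then show "\<forall>\<^sub>F t in F. f t \<in> U" using fS by eventually_elim (simp add: T)
next
  fix K C assume K: "compactin (top_of_set S) K"
    and C: "C \<in> connected_components_of (subtopology (top_of_set S) (topspace (top_of_set S) - K))"
    and "Inl x \<in> Inl ` C \<union> Inr ` {E \<in> ends_of (top_of_set S). E K = C}"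
  then have x: "x \<in> C" by blast
  have CS: "C \<subseteq> S - K" using connected_components_of_subset[OF C] by auto
  have "closed K" using K by (simp add: compactin_subtopology compact_imp_closed)
  then obtain e where e: "e > 0" "ball x e \<subseteq> - K"
    using x CS open_contains_ball[of "- K"] by (meson ComplI DiffD2 open_Compl subsetD)
  have "connected (ball x e \<inter> S)" by (intro convex_connected convex_Int convex_ball S)
  then have "connectedin (subtopology (top_of_set S) (topspace (top_of_set S) - K)) (ball x e \<inter> S)"
    using e by (auto simp: connectedin_subtopology)
  moreover have "\<not> disjnt C (ball x e \<inter> S)" using x e S by (auto simp: disjnt_def)
  ultimately have sub: "ball x e \<inter> S \<subseteq> C" by (rule connected_components_of_maximal[OF C])
  have "\<forall>\<^sub>F t in F. f t \<in> ball x e" using e by (intro topological_tendstoD[OF lim]) auto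
  then show "\<forall>\<^sub>F t in F. f t \<in> C" using fS by eventually_elim (use sub in blast)
qed

lemma limitin_end_compactification_Inr:
  fixes f :: "real \<Rightarrow> 'a::topological_space"
  assumes cont: "continuous_on {a..} f" and fS: "f ` {a..} \<subseteq> S"
    and leave: "\<And>K. compact K \<Longrightarrow> K \<subseteq> S \<Longrightarrow> \<forall>\<^sub>F t in at_top. f t \<notin> K"
  shows "\<exists>E\<in>ends_of (top_of_set S). limitin (end_compactification (top_of_set S)) (\<lambda>t. Inl (f t)) (Inr E) at_top"
proof -
  let ?X = "top_of_set S"
  let ?Y = "\<lambda>K. subtopology ?X (topspace ?X - K)"
  have "\<exists>T\<ge>a. \<forall>t\<ge>T. f t \<in> S - K" if "compactin ?X K" for K
  proof -
    have "\<forall>\<^sub>F t in at_top. f t \<notin> K" using that by (intro leave) (auto simp: compactin_subtopology)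
    then obtain T where "\<And>t. t \<ge> T \<Longrightarrow> f t \<notin> K" by (auto simp: eventually_at_top_linorder)
    then show ?thesis using fS by (intro exI[of _ "max a T"]) auto
  qed
  then obtain T where T: "\<And>K. compactin ?X K \<Longrightarrow> T K \<ge> a" "\<And>K t. compactin ?X K \<Longrightarrow> t \<ge> T K \<Longrightarrow> f t \<in> S - K"
    by metis
  define E where "E K = (if compactin ?X K then connected_component_of_set (?Y K) (f (T K)) else {})" for K
  have E_comp: "E K \<in> connected_components_of (?Y K)" if "compactin ?X K" for K
    using T(2)[OF that order_refl] that
    by (simp add: E_def connected_component_in_connected_components_of)
  have E_tail: "f t \<in> E K" if K: "compactin ?X K" and t: "t \<ge> T K" for K t
  proof -
    have "connected (f ` {T K..})"
      by (intro connected_continuous_image continuous_on_subset[OF cont] connected_Ici) (use T(1)[OF K] in auto)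
    moreover have "f ` {T K..} \<subseteq> S - K" using T(2)[OF K] by auto
    ultimately have "connectedin (?Y K) (f ` {T K..})" by (auto simp: connectedin_subtopology)
    then have "f ` {T K..} \<subseteq> connected_component_of_set (?Y K) (f (T K))"
      by (rule connected_component_of_maximal) auto
    then show ?thesis using t K by (auto simp: E_def)
  qed
  have E: "E \<in> ends_of ?X"
    unfolding ends_of_def
  proof (intro CollectI conjI allI impI)
    fix K L assume KL: "compactin ?X K \<and> compactin ?X L \<and> K \<subseteq> L"
    have "connectedin (?Y L) (E L)" using KL by (intro connectedin_connected_components_of E_comp) auto
    then have "connectedin (?Y K) (E L)" using KL by (auto simp: connectedin_subtopology)
    moreover have "\<not> disjnt (E K) (E L)"
      using E_tail[of K "max (T K) (T L)"] E_tail[of L "max (T K) (T L)"] KL by (auto simp: disjnt_def)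
    ultimately show "E L \<subseteq> E K" using connected_components_of_maximal[OF E_comp] KL by blast
  qed (use E_comp in \<open>auto simp: E_def\<close>)
  have "limitin (end_compactification ?X) (\<lambda>t. Inl (f t)) (Inr E) at_top"
  proof (rule limitin_end_compactificationI)
    show "Inr E \<in> topspace (end_compactification ?X)"
      using E by (simp add: topspace_end_compactification)
    fix K C assume K: "compactin ?X K" and "Inr E \<in> Inl ` C \<union> Inr ` {E \<in> ends_of ?X. E K = C}"
    then have "E K = C" by auto
    then show "\<forall>\<^sub>F t in at_top. f t \<in> C"
      using E_tail[OF K] by (auto simp: eventually_at_top_linorder)
  qed auto
  then show ?thesis using E by blast
qed

subsection \<open>Geodesic rays\<close>

lemma kobayashi_modulus_small:
  assumes "e > 0"
  obtains \<kappa> where "\<kappa> > 0" "kobayashi_modulus \<kappa> < e"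
proof -
  have "isCont kobayashi_modulus 0"
    unfolding kobayashi_modulus_def[abs_def] by (intro continuous_intros)
  then have "kobayashi_modulus \<midarrow>0\<rightarrow> kobayashi_modulus 0" by (simp add: isCont_def)
  then have "(kobayashi_modulus \<longlongrightarrow> 0) (at_right 0)"
    by (simp add: kobayashi_modulus_def tendsto_within_subset filterlim_at_split)
  then have "\<forall>\<^sub>F \<kappa> in at_right 0. kobayashi_modulus \<kappa> < e" using assms by (rule order_tendstoD(2))
  moreover have "\<forall>\<^sub>F \<kappa> in at_right (0::real). \<kappa> > 0" by (rule eventually_at_right_less)
  ultimately have "\<forall>\<^sub>F \<kappa> in at_right 0. \<kappa> > 0 \<and> kobayashi_modulus \<kappa> < e" by eventually_elim simp
  then have "\<exists>\<kappa>. \<kappa> > 0 \<and> kobayashi_modulus \<kappa> < e"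
    by (intro eventually_happens'[of "at_right 0"]) simp_all
  then show ?thesis using that by blast
qed

locale kobayashi_ray =
  fixes \<Omega> :: "(complex ^ 'd) set" and \<sigma> :: "real \<Rightarrow> complex ^ 'd"
  assumes properly_convex: "\<Omega> \<in> \<bbbX>" and ray: "kobayashi_geodesic_ray \<Omega> \<sigma>"
begin

lemma \<Omega>: "C_properly_convex \<Omega>" "\<Omega> \<noteq> {}" "open \<Omega>" "convex \<Omega>"
  using properly_convex by (auto simp: properly_convex_domains_def C_properly_convex_def)

lemma ray_mem: "t \<ge> 0 \<Longrightarrow> \<sigma> t \<in> \<Omega>"
  using ray by (simp add: kobayashi_geodesic_ray_def)

lemma ray_disc_in:
  assumes "s \<ge> 0" "t \<ge> 0" "\<bar>s - t\<bar> \<le> \<kappa>" "\<kappa> > 0"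
  shows "disc_in \<Omega> (\<sigma> s) ((1 / kobayashi_modulus \<kappa>) *\<^sub>R (\<sigma> t - \<sigma> s))"
proof -
  obtain n ps f \<alpha> \<beta> where "disc_chain \<Omega> (\<sigma> s) (\<sigma> t) n ps f \<alpha> \<beta>"
    using disc_chain_in_domain[OF \<Omega>(3,4) ray_mem ray_mem] assms by blast
  then show ?thesis
    using assms ray by (intro disc_in_of_kobayashi_dist_le[OF \<Omega>(3,4) ray_mem ray_mem])
      (auto simp: kobayashi_geodesic_ray_def)
qed

lemma ray_continuous: "continuous_on {0..} \<sigma>"
  unfolding continuous_on_iff
proof (intro ballI allI impI)
  fix s e :: real assume s: "s \<in> {0..}" and e: "e > 0"
  have "\<sigma> s \<in> closure \<Omega> \<inter> cball 0 (norm (\<sigma> s))"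
    using ray_mem[of s] s closure_subset[of \<Omega>] by auto
  then obtain b where b: "b > 0" "\<And>w. disc_in \<Omega> (\<sigma> s) w \<Longrightarrow> norm w \<le> b"
    using disc_in_bounded[OF \<Omega>(1,2), of "norm (\<sigma> s)"] by blast
  obtain \<kappa> where \<kappa>: "\<kappa> > 0" "kobayashi_modulus \<kappa> < e / b"
    using kobayashi_modulus_small[of "e / b"] b e by auto
  have "dist (\<sigma> t) (\<sigma> s) < e" if t: "t \<in> {0..}" "dist t s < \<kappa>" for t
  proof -
    have "norm ((1 / kobayashi_modulus \<kappa>) *\<^sub>R (\<sigma> t - \<sigma> s)) \<le> b"
      using s t \<kappa> by (intro b(2) ray_disc_in) (auto simp: dist_real_def)
    then have "norm (\<sigma> t - \<sigma> s) \<le> b * kobayashi_modulus \<kappa>"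
      using kobayashi_modulus_pos[OF \<kappa>(1)] by (simp add: pos_divide_le_eq)
    also have "\<dots> < e" using \<kappa>(2) b by (simp add: pos_less_divide_eq mult.commute)
    finally show ?thesis by (simp add: dist_norm)
  qed
  then show "\<exists>d>0. \<forall>t\<in>{0..}. dist t s < d \<longrightarrow> dist (\<sigma> t) (\<sigma> s) < e" using \<kappa>(1) by blast
qed

lemma ray_boundary_distance_decay:
  assumes K: "K \<ge> 1" and r0: "r0 > 0"
  shows "\<exists>T0\<ge>0. \<exists>T>0. \<forall>k t. T0 + real k * T \<le> t \<longrightarrow> norm (\<sigma> t) \<le> R \<longrightarrow>
    infdist (\<sigma> t) (- \<Omega>) * K ^ k \<le> r0"
proof -
  obtain \<rho> where \<rho>: "\<rho> > 0" "ball (\<sigma> 0) \<rho> \<subseteq> \<Omega>" using \<Omega>(3) ray_mem[of 0] open_contains_ball by blast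
  define R1 where "R1 = \<bar>R\<bar> + norm (\<sigma> 0) + \<rho>"
  have R1: "R1 > 0" "\<rho> \<le> R1" using \<rho> by (auto simp: R1_def add_nonneg_pos)
  define q where "q = \<rho> / (2 * R1)"
  have q: "0 < q" "q < 1" "2 * q * R1 \<le> \<rho>" using \<rho> R1 by (auto simp: q_def)
  obtain m where m: "(1 - q) ^ m < 1 / K" using real_arch_pow_inv[of "1 / K" "1 - q"] K q by auto
  have m0: "m \<noteq> 0"
  proof
    assume "m = 0"
    then show False using m K by (simp add: pos_less_divide_eq)
  qed
  obtain N0 where N0: "(1 - q) ^ N0 < r0 / (2 * R1)"
    using real_arch_pow_inv[of "r0 / (2 * R1)" "1 - q"] r0 R1 q by auto
  define c :: real where "c = artanh (1 / 2)"
  have c: "c > 0" by (simp add: c_def artanh_def)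
  define T0 where "T0 = (real N0 + 2) * c"
  define T where "T = real m * c"
  have "infdist (\<sigma> t) (- \<Omega>) * K ^ k \<le> r0" if t: "T0 + real k * T \<le> t" and tR: "norm (\<sigma> t) \<le> R" for k t
  proof (rule ccontr)
    let ?\<delta> = "infdist (\<sigma> t) (- \<Omega>)"
    assume "\<not> ?\<delta> * K ^ k \<le> r0"
    then have \<delta>: "r0 < ?\<delta> * K ^ k" by simp
    have Kk: "K ^ k > 0" using K by simp
    have \<delta>0: "?\<delta> > 0" using \<delta> r0 Kk by (metis less_trans zero_less_mult_pos2)
    have t0: "t \<ge> 0" using t c by (intro order_trans[OF _ t]) (simp add: T0_def T_def)
    define N where "N = N0 + m * k"
    have "((1 - q) ^ m) ^ k \<le> (1 / K) ^ k" using m q by (intro power_mono) auto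
    then have "2 * R1 * (1 - q) ^ N0 * ((1 - q) ^ m) ^ k \<le> r0 * (1 / K) ^ k"
      using N0 R1 q r0 by (intro mult_mono) (auto simp: pos_less_divide_eq mult.commute less_imp_le)
    also have "\<dots> \<le> ?\<delta>" using \<delta> Kk by (simp add: power_one_over pos_divide_le_eq)
    finally have "2 * R1 * (1 - q) ^ N0 * ((1 - q) ^ m) ^ k \<le> ?\<delta>" .
    moreover have "2 * (1 - q) ^ N * R1 = 2 * R1 * (1 - q) ^ N0 * ((1 - q) ^ m) ^ k"
      unfolding N_def power_add power_mult by (simp only: mult_ac)
    ultimately have N: "2 * (1 - q) ^ N * R1 \<le> ?\<delta>" by (simp only:)
    have "norm (\<sigma> 0 - \<sigma> t) \<le> R1"
      using norm_triangle_ineq4[of "\<sigma> 0" "\<sigma> t"] tR \<rho> unfolding R1_def by linarith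
    from disc_chain_exists[OF \<Omega>(4) \<rho> \<delta>0 ball_infdist_subset this q N]
    obtain ps f \<alpha> \<beta> where ch: "disc_chain \<Omega> (\<sigma> 0) (\<sigma> t) (Suc N) ps f \<alpha> \<beta>"
      and "(\<Sum>i<Suc N. poincare_dist (\<alpha> i) (\<beta> i)) = real (Suc N) * c" unfolding c_def by blast
    then have "kobayashi_dist \<Omega> (\<sigma> 0) (\<sigma> t) \<le> real (Suc N) * c"
      using kobayashi_dist_le_chain[OF ch] by simp
    then have "t \<le> real (Suc N) * c" using ray t0 by (simp add: kobayashi_geodesic_ray_def)
    also have "\<dots> < T0 + real k * T" using c by (simp add: N_def T0_def T_def algebra_simps)
    finally show False using t by simp
  qed
  moreover have "T0 \<ge> 0" "T > 0" using c m0 by (auto simp: T0_def T_def)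
  ultimately show ?thesis by blast
qed

lemma ray_accumulation_not_mem:
  assumes acc: "\<And>e T. e > 0 \<Longrightarrow> \<exists>t\<ge>T. dist (\<sigma> t) x < e"
  shows "x \<notin> \<Omega>"
proof
  assume "x \<in> \<Omega>"
  then obtain e where e: "e > 0" "ball x e \<subseteq> \<Omega>" using \<Omega>(3) open_contains_ball by blast
  then have ex: "e \<le> infdist x (- \<Omega>)"
    using infdist_ge_of_ball_subset[OF C_properly_convex_complement_nonempty[OF \<Omega>(1)]] by blast
  obtain T0 where T0: "\<And>t. T0 \<le> t \<Longrightarrow> norm (\<sigma> t) \<le> norm x + e \<Longrightarrow> infdist (\<sigma> t) (- \<Omega>) \<le> e / 2"
  proof -
    obtain T0 T where "\<forall>k t. T0 + real k * T \<le> t \<longrightarrow> norm (\<sigma> t) \<le> norm x + e \<longrightarrow>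
        infdist (\<sigma> t) (- \<Omega>) * 1 ^ k \<le> e / 2"
      using ray_boundary_distance_decay[of 1 "e / 2" "norm x + e"] e by auto
    from this[rule_format, of 0] show ?thesis using that[of T0] by simp
  qed
  obtain t where t: "t \<ge> T0" "dist (\<sigma> t) x < e / 2" using acc[of "e / 2" T0] e by auto
  have "norm (\<sigma> t) \<le> norm x + e"
    using norm_triangle_ineq2[of "\<sigma> t" x] t(2) e(1) by (simp add: dist_norm)
  then have "infdist (\<sigma> t) (- \<Omega>) \<le> e / 2" using T0 t by blast
  then show False
    using infdist_triangle[of x "- \<Omega>" "\<sigma> t"] ex t(2) by (simp add: dist_commute)
qed

text \<open>The discs through \<open>\<sigma> t\<close>, hence the displacements of \<open>\<sigma>\<close> over a fixed time, decay
  geometrically as long as \<open>\<sigma>\<close> stays in a fixed ball; once \<open>\<sigma>\<close> is close to \<open>x\<close> the remaining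
  displacements are too small to leave it.\<close>

lemma ray_accumulation_limit:
  assumes simple: "\<forall>D \<in> aff_orbit_closure \<Omega>. simple_boundary D"
    and acc: "\<And>e T. e > 0 \<Longrightarrow> \<exists>t\<ge>T. dist (\<sigma> t) x < e"
  shows "(\<sigma> \<longlongrightarrow> x) at_top"
proof -
  define R where "R = norm x + 1"
  obtain C \<theta> K r0 where C: "C > 0" and \<theta>: "0 < \<theta>" "\<theta> < 1" and K: "K \<ge> 1" and r0: "r0 > 0"
    and decay: "\<And>k p w. p \<in> \<Omega> \<inter> cball 0 R \<Longrightarrow> infdist p (- \<Omega>) * K ^ k \<le> r0 \<Longrightarrow>
      disc_in \<Omega> p w \<Longrightarrow> norm w \<le> C * \<theta> ^ k"
    using disc_size_decay[OF properly_convex simple, of R] by blast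
  obtain T0 T where T0: "T0 \<ge> 0" and T: "T > 0"
    and bd: "\<And>k t. T0 + real k * T \<le> t \<Longrightarrow> norm (\<sigma> t) \<le> R \<Longrightarrow> infdist (\<sigma> t) (- \<Omega>) * K ^ k \<le> r0"
    using ray_boundary_distance_decay[OF K r0, of R] by blast
  define B where "B = C * kobayashi_modulus T"
  have B: "B > 0" using C kobayashi_modulus_pos[OF T] by (simp add: B_def)
  have step: "dist (\<sigma> s) (\<sigma> t) \<le> B * \<theta> ^ k"
    if t: "T0 + real k * T \<le> t" "norm (\<sigma> t) \<le> R" and s: "t \<le> s" "s \<le> t + T" for k s t
  proof -
    have t0: "t \<ge> 0" using t(1) T0 T by (intro order_trans[OF _ t(1)]) simp
    have "norm ((1 / kobayashi_modulus T) *\<^sub>R (\<sigma> s - \<sigma> t)) \<le> C * \<theta> ^ k"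
      using t0 s T t by (intro decay[OF _ bd[OF t] ray_disc_in]) (auto intro: ray_mem)
    then show ?thesis
      using kobayashi_modulus_pos[OF T] by (simp add: B_def dist_norm pos_divide_le_eq mult_ac)
  qed
  have near: "\<exists>t. \<forall>s\<ge>t. dist (\<sigma> s) x < e" if e: "0 < e" "e < 1" for e
  proof -
    define b where "b = (1 - \<theta>) * e / (2 * B)"
    have "b > 0" using \<theta> e B by (simp add: b_def)
    then obtain k1 where k1: "\<theta> ^ k1 < b" using real_arch_pow_inv[OF _ \<theta>(2)] by blast
    define G where "G = B * \<theta> ^ k1 / (1 - \<theta>)"
    have G: "G < e / 2" "G > 0"
    proof -
      have "B * \<theta> ^ k1 < B * b" using k1 B by simp
      also have "\<dots> = (1 - \<theta>) * (e / 2)" using B by (simp add: b_def)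
      finally show "G < e / 2" using \<theta> by (simp add: G_def pos_divide_less_eq mult.commute)
      show "G > 0" using B \<theta> by (simp add: G_def)
    qed
    obtain u where u: "u \<ge> T0 + real k1 * T" "dist (\<sigma> u) x < e / 2"
      using acc[of "e / 2" "T0 + real k1 * T"] e by auto
    have close: "norm (\<sigma> s) \<le> R" if "dist (\<sigma> s) (\<sigma> u) \<le> G" for s
    proof -
      have "dist (\<sigma> s) x < 1" using dist_triangle[of "\<sigma> s" x "\<sigma> u"] that u(2) G e by linarith
      then show ?thesis using norm_triangle_ineq2[of "\<sigma> s" x] unfolding R_def dist_norm by linarith
    qed
    have ind: "dist (\<sigma> s) (\<sigma> u) \<le> G * (1 - \<theta> ^ Suc j)"
      if "u + real j * T \<le> s" "s \<le> u + real (Suc j) * T" for j s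
      using that
    proof (induction j arbitrary: s)
      case 0
      have "dist (\<sigma> s) (\<sigma> u) \<le> B * \<theta> ^ k1"
        using 0 u(1) G by (intro step close) auto
      also have "\<dots> = G * (1 - \<theta> ^ Suc 0)" using \<theta> by (simp add: G_def)
      finally show ?case .
    next
      case (Suc j)
      let ?u = "u + real (Suc j) * T"
      have 1: "dist (\<sigma> ?u) (\<sigma> u) \<le> G * (1 - \<theta> ^ Suc j)" using T by (intro Suc.IH) auto
      also have "\<dots> \<le> G" using G \<theta> by (simp add: mult_left_le)
      finally have "norm (\<sigma> ?u) \<le> R" by (rule close)
      then have "dist (\<sigma> s) (\<sigma> ?u) \<le> B * \<theta> ^ (k1 + Suc j)"
        using Suc.prems u(1) by (intro step) (auto simp: algebra_simps)
      also have "\<dots> = G * (\<theta> ^ Suc j - \<theta> ^ Suc (Suc j))"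
        using \<theta> by (simp add: G_def power_add field_simps)
      finally show ?case
        using 1 dist_triangle[of "\<sigma> s" "\<sigma> u" "\<sigma> ?u"] by (simp add: algebra_simps)
    qed
    have "dist (\<sigma> s) x < e" if s: "s \<ge> u" for s
    proof -
      define j where "j = nat \<lfloor>(s - u) / T\<rfloor>"
      have "real j \<le> (s - u) / T" "(s - u) / T \<le> real (Suc j)"
        using s T by (auto simp: j_def) linarith
      then have "dist (\<sigma> s) (\<sigma> u) \<le> G * (1 - \<theta> ^ Suc j)"
        using T by (intro ind) (auto simp: pos_le_divide_eq pos_divide_le_eq algebra_simps)
      also have "\<dots> \<le> G" using G \<theta> by (simp add: mult_left_le)
      finally show ?thesis using dist_triangle[of "\<sigma> s" x "\<sigma> u"] u(2) G by linarith
    qed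
    then show ?thesis by blast
  qed
  show ?thesis
  proof (rule tendstoI)
    fix e :: real assume "e > 0"
    then have "0 < min e (1/2)" "min e (1/2) < 1" by auto
    then obtain t where t: "\<And>s. s \<ge> t \<Longrightarrow> dist (\<sigma> s) x < min e (1/2)" using near by blast
    then show "\<forall>\<^sub>F s in at_top. dist (\<sigma> s) x < e"
      unfolding eventually_at_top_linorder by (intro exI[of _ t]) auto
  qed
qed

end

theorem proposition8p3:
  fixes \<Omega> :: "(complex ^ 'd) set" and \<sigma> :: "real \<Rightarrow> complex ^ 'd"
  assumes "\<Omega> \<in> \<bbbX>"
    and "\<forall>D \<in> aff_orbit_closure \<Omega>. simple_boundary D"
    and "kobayashi_geodesic_ray \<Omega> \<sigma>"
  shows "\<exists>\<xi> \<in> end_boundary \<Omega>.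
    limitin (end_compactification (top_of_set (closure \<Omega>))) (\<lambda>t. Inl (\<sigma> t)) \<xi> at_top"
proof -
  interpret kobayashi_ray \<Omega> \<sigma> by unfold_locales (use assms in auto)
  have mem: "\<sigma> t \<in> closure \<Omega>" if "t \<ge> 0" for t using ray_mem[OF that] closure_subset by blast
  show ?thesis
  proof (cases "\<exists>x. \<forall>e>0. \<forall>T. \<exists>t\<ge>T. dist (\<sigma> t) x < e")
    case True
    then obtain x where acc: "\<And>e T. e > 0 \<Longrightarrow> \<exists>t\<ge>T. dist (\<sigma> t) x < e" by blast
    have lim: "(\<sigma> \<longlongrightarrow> x) at_top" by (rule ray_accumulation_limit[OF assms(2) acc])
    have ev: "\<forall>\<^sub>F t in at_top. \<sigma> t \<in> closure \<Omega>"
      using eventually_ge_at_top[of 0] by eventually_elim (rule mem)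
    have x: "x \<in> closure \<Omega>" by (rule Lim_in_closed_set[OF closed_closure ev _ lim]) simp
    have "x \<notin> \<Omega>" by (rule ray_accumulation_not_mem[OF acc])
    then have "Inl x \<in> end_boundary \<Omega>"
      using x by (auto simp: end_boundary_def topspace_end_compactification)
    moreover have "limitin (end_compactification (top_of_set (closure \<Omega>))) (\<lambda>t. Inl (\<sigma> t)) (Inl x) at_top"
      by (rule limitin_end_compactification_Inl[OF convex_closure[OF \<Omega>(4)] x lim ev])
    ultimately show ?thesis by blast
  next
    case False
    have leave: "\<forall>\<^sub>F t in at_top. \<sigma> t \<notin> K" if K: "compact K" for K
    proof (rule ccontr)
      assume "\<not> ?thesis"
      then have "\<exists>t\<ge>real n. \<sigma> t \<in> K" for n :: nat by (auto simp: eventually_at_top_linorder)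
      then obtain \<tau> where \<tau>: "\<And>n. \<tau> n \<ge> real n" "\<And>n. \<sigma> (\<tau> n) \<in> K" by metis
      have "\<forall>n. (\<lambda>n. \<sigma> (\<tau> n)) n \<in> K" using \<tau> by simp
      with K obtain x r where x: "strict_mono (r :: nat \<Rightarrow> nat)" "((\<lambda>n. \<sigma> (\<tau> n)) \<circ> r) \<longlonglongrightarrow> x"
        by (rule compact_subsequence)
      have "\<exists>t\<ge>T. dist (\<sigma> t) x < e" if e: "e > 0" for e T
      proof -
        have "\<forall>\<^sub>F n in sequentially. dist (\<sigma> (\<tau> (r n))) x < e" using tendstoD[OF x(2) e] by (simp add: o_def)
        moreover have "\<forall>\<^sub>F n in sequentially. n \<ge> nat \<lceil>T\<rceil>" by (rule eventually_ge_at_top)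
        ultimately have "\<forall>\<^sub>F n in sequentially. dist (\<sigma> (\<tau> (r n))) x < e \<and> \<tau> (r n) \<ge> T"
        proof eventually_elim
          case (elim n)
          have "T \<le> real n" using elim(2) by linarith
          also have "\<dots> \<le> real (r n)" using seq_suble[OF x(1), of n] by simp
          also have "\<dots> \<le> \<tau> (r n)" by (rule \<tau>)
          finally show ?case using elim by simp
        qed
        then show ?thesis using eventually_happens'[OF sequentially_bot] by blast
      qed
      then show False using False by blast
    qed
    have "\<exists>E\<in>ends_of (top_of_set (closure \<Omega>)).
        limitin (end_compactification (top_of_set (closure \<Omega>))) (\<lambda>t. Inl (\<sigma> t)) (Inr E) at_top"
      by (rule limitin_end_compactification_Inr[OF ray_continuous _ leave]) (use mem in auto)
    then obtain E where E: "E \<in> ends_of (top_of_set (closure \<Omega>))"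
      "limitin (end_compactification (top_of_set (closure \<Omega>))) (\<lambda>t. Inl (\<sigma> t)) (Inr E) at_top" by blast
    have "Inr E \<in> end_boundary \<Omega>"
      using E(1) by (auto simp: end_boundary_def topspace_end_compactification)
    then show ?thesis using E(2) by blast
  qed
qed

end
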